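(* For every $m\geq1$, $$\rho(p_m)=\delta^mE=\delta^{m-1}\mathcal G_1 .$$ Consequently, if $\lambda\vdash n$, then $\rho(p_\lambda)=\delta^nE^{\ell(\lambda)}$. Moreover, $$\ker\rho=\bigl\langle\, p_ip_{j+1}-p_{i+1}p_j:\ 1\leq i<j\,\bigr\rangle ,$$ the ideal of $\Lambda$ generated by these elements. In particular, for $n\geq1$, $$\rho(\Lambda_n)=\delta^n\,\mathrm{span}_{\mathbb Q}\{E,E^2,\ldots,E^n\},\qquad \dim\ker(\rho|_{\Lambda_n})=p(n)-n,$$ where $p(n)$ is the number of partitions of $n$.
   Context: Work over $\mathbb Q$. With $D=\partial_x+\partial_y$, put $\mathcal G_0=\mathrm{id}$ and $\mathcal G_r=y^r\sum_{j=1}^{r}\binom{r-1}{j-1}\frac{x^j}{j!}D^j$ for $r\geq1$, operators on $\mathbb Q[x,y]$; they commute pairwise. $\Lambda=\mathbb Q[h_1,h_2,\ldots]$ is the ring of symmetric functions over $\mathbb Q$ in variables $z_1,z_2,\ldots$, freely generated by the complete homogeneous functions $h_r$, and $\Lambda_n$ is its degree-$n$ component. $\rho:\Lambda\to\mathrm{End}_{\mathbb Q}(\mathbb Q[x,y])$ is the unique unital algebra homomorphism with $\rho(h_r)=\mathcal G_r$ (the product in the endomorphism algebra is composition). The power sums are $p_m=\sum_{i\geq1}z_i^m$, and for a partition $\lambda=(\lambda_1,\ldots,\lambda_\ell)$, $p_\lambda=p_{\lambda_1}\cdots p_{\lambda_\ell}$, $\ell(\lambda)=\ell$. Put $\delta=y-x$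 and $u=x/y$, so that $\mathbb Q(x,y)=\mathbb Q(\delta,u)$; $E=u\partial_u$ is the $\mathbb Q$-derivation of $\mathbb Q(\delta,u)$ with $E(\delta)=0$, $E(u)=u$. $\delta$ also denotes multiplication by $y-x$. One has $\delta E=xyD=\mathcal G_1$, and for $1\le\ell\leq n$ the operator $\delta^nE^\ell=(y-x)^{n-\ell}(xyD)^\ell$ maps $\mathbb Q[x,y]$ to itself; it is in this sense that $\delta^nE^\ell$ is regarded as an element of $\mathrm{End}_{\mathbb Q}(\mathbb Q[x,y])$. *)

theory Defs
  imports
    "HOL-Library.Multiset"
    "HOL-Computational_Algebra.Polynomial_Factorial"
begin

text \<open>
  A monomial in the variables \<open>z\<^sub>0, z\<^sub>1, \<dots>\<close> is encoded as the finite multiset of its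
  variable indices; the product of monomials is the sum of multisets and the degree is the
  size. A formal power series is its coefficient function. A symmetric function is a series
  of bounded degree that is invariant under all permutations of the variables.
\<close>

typedef symfun =
  "{f :: nat multiset \<Rightarrow> rat.
     (\<exists>d. \<forall>M. f M \<noteq> 0 \<longrightarrow> size M \<le> d) \<and>
     (\<forall>\<pi> M. bij \<pi> \<longrightarrow> f (image_mset \<pi> M) = f M)}"
  morphisms sf_coeff Abs_symfun
  by (rule exI[of _ "\<lambda>_. 0"]) auto

setup_lifting type_definition_symfun

lemma finite_submultisets: "finite {A. A \<subseteq># (M :: 'a multiset)}"
proof -
  have "{A. A \<subseteq># M} \<subseteq> (\<Union>n\<le>size M. {A. set_mset A \<subseteq> set_mset M \<and> size A = n})"
    by (auto dest: size_mset_mono mset_subset_eqD)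
  moreover have "finite {A. set_mset A \<subseteq> set_mset M \<and> size A = n}" for n
  proof -
    have "{A. set_mset A \<subseteq> set_mset M \<and> size A = n}
            \<subseteq> mset ` {xs. set xs \<subseteq> set_mset M \<and> length xs = n}"
    proof
      fix A assume A: "A \<in> {A. set_mset A \<subseteq> set_mset M \<and> size A = n}"
      obtain xs where "mset xs = A" using ex_mset by blast
      with A show "A \<in> mset ` {xs. set xs \<subseteq> set_mset M \<and> length xs = n}" by auto
    qed
    thus ?thesis
      by (rule finite_subset) (intro finite_imageI finite_lists_length_eq, simp)
  qed
  ultimately show ?thesis by (rule finite_subset[OF _ finite_UN_I[OF finite_atMost]])
qed

lemma diff_diff_submultiset: "A \<subseteq># M \<Longrightarrow> M - (M - A) = (A :: 'a multiset)"
  by (auto simp: multiset_eq_iff subseteq_mset_def)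

definition sf_conv :: "(nat multiset \<Rightarrow> rat) \<Rightarrow> (nat multiset \<Rightarrow> rat) \<Rightarrow> nat multiset \<Rightarrow> rat" where
  "sf_conv f g M = (\<Sum>A | A \<subseteq># M. f A * g (M - A))"

lemma sf_conv_commute: "sf_conv f g M = sf_conv g f M"
  unfolding sf_conv_def
  by (rule sum.reindex_bij_witness[where i = "\<lambda>A. M - A" and j = "\<lambda>A. M - A"])
     (auto simp: diff_diff_submultiset mult.commute)

lemma sf_conv_assoc: "sf_conv (sf_conv f g) h M = sf_conv f (sf_conv g h) M"
proof -
  have "sf_conv (sf_conv f g) h M =
      (\<Sum>(A, B) \<in> (SIGMA A:{A. A \<subseteq># M}. {B. B \<subseteq># A}). f B * g (A - B) * h (M - A))"
    unfolding sf_conv_def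
    by (subst sum.Sigma[symmetric]) (auto simp: finite_submultisets sum_distrib_right)
  also have "\<dots> =
      (\<Sum>(B, C) \<in> (SIGMA B:{B. B \<subseteq># M}. {C. C \<subseteq># M - B}). f B * (g C * h (M - B - C)))"
  proof (rule sum.reindex_bij_witness[where i = "\<lambda>(B, C). (B + C, B)" and j = "\<lambda>(A, B). (B, A - B)"])
    fix x assume "x \<in> (SIGMA B:{B. B \<subseteq># M}. {C. C \<subseteq># M - B})"
    thus "(case x of (B, C) \<Rightarrow> (B + C, B)) \<in> (SIGMA A:{A. A \<subseteq># M}. {B. B \<subseteq># A})"
      by (auto simp: subset_mset.le_diff_conv2 add.commute)
  next
    fix x assume "x \<in> (SIGMA A:{A. A \<subseteq># M}. {B. B \<subseteq># A})"
    thus "(case x of (A, B) \<Rightarrow> (B, A - B)) \<in> (SIGMA B:{B. B \<subseteq># M}. {C. C \<subseteq># M - B})"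
      by (clarsimp simp: subseteq_mset_def) (meson diff_le_mono order_trans)
  next
    fix x assume "x \<in> (SIGMA A:{A. A \<subseteq># M}. {B. B \<subseteq># A})"
    moreover have "M - B - (A - B) = M - A" if "B \<subseteq># A" for A B
      using that by (metis diff_diff_add_mset subset_mset.add_diff_inverse)
    ultimately show "(case case x of (A, B) \<Rightarrow> (B, A - B) of (B, C) \<Rightarrow> f B * (g C * h (M - B - C)))
        = (case x of (A, B) \<Rightarrow> f B * g (A - B) * h (M - A))"
      by (auto simp: mult.assoc)
  qed auto
  also have "\<dots> = sf_conv f (sf_conv g h) M"
    unfolding sf_conv_def
    by (subst sum.Sigma[symmetric]) (auto simp: finite_submultisets sum_distrib_left)
  finally show ?thesis .
qed

lemma sf_conv_image_mset:
  assumes "bij \<pi>"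
    and "\<And>M. f (image_mset \<pi> M) = f M" and "\<And>M. g (image_mset \<pi> M) = g M"
  shows "sf_conv f g (image_mset \<pi> M) = sf_conv f g M"
proof -
  have inv: "image_mset (inv \<pi>) (image_mset \<pi> A) = A" "image_mset \<pi> (image_mset (inv \<pi>) A) = A" for A
    using assms(1)
    by (simp_all add: multiset.map_comp bij_is_inj bij_is_surj surj_iff[symmetric] o_def surj_f_inv_f)
  show ?thesis
    unfolding sf_conv_def
  proof (rule sum.reindex_bij_witness[where i = "image_mset \<pi>" and j = "image_mset (inv \<pi>)"])
    fix A assume "A \<in> {A. A \<subseteq># image_mset \<pi> M}"
    hence A: "A \<subseteq># image_mset \<pi> M" by simp
    show sub: "image_mset (inv \<pi>) A \<in> {A. A \<subseteq># M}"
      using image_mset_subseteq_mono[OF A, of "inv \<pi>"] inv by simp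
    have "f (image_mset (inv \<pi>) A) = f A"
      using assms(2)[of "image_mset (inv \<pi>) A"] inv by simp
    moreover have "image_mset \<pi> (M - image_mset (inv \<pi>) A) = image_mset \<pi> M - A"
      using sub inv by (simp add: image_mset_Diff)
    hence "g (M - image_mset (inv \<pi>) A) = g (image_mset \<pi> M - A)"
      using assms(3) by metis
    ultimately show "f (image_mset (inv \<pi>) A) * g (M - image_mset (inv \<pi>) A)
        = f A * g (image_mset \<pi> M - A)" by simp
  qed (auto simp: inv image_mset_subseteq_mono)
qed

lemma sf_conv_bounded:
  assumes "\<forall>M. f M \<noteq> 0 \<longrightarrow> size M \<le> d" "\<forall>M. g M \<noteq> 0 \<longrightarrow> size M \<le> e" "sf_conv f g M \<noteq> 0"
  shows "size M \<le> d + e"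
proof -
  obtain A where A: "A \<subseteq># M" "f A * g (M - A) \<noteq> 0"
    using assms(3) unfolding sf_conv_def by (auto elim: sum.not_neutral_contains_not_neutral)
  hence "size A \<le> d" "size (M - A) \<le> e" using assms by auto
  moreover have "size M = size A + size (M - A)"
    using A(1) by (metis size_union subset_mset.add_diff_inverse)
  ultimately show ?thesis by simp
qed

instantiation symfun :: comm_ring_1
begin

lift_definition zero_symfun :: symfun is "\<lambda>_. 0" by auto

lift_definition one_symfun :: symfun is "\<lambda>M. if M = {#} then 1 else 0" by auto

lift_definition plus_symfun :: "symfun \<Rightarrow> symfun \<Rightarrow> symfun" is "\<lambda>f g M. f M + g M"
proof (intro conjI)
  fix f g :: "nat multiset \<Rightarrow> rat"
  assume "(\<exists>d. \<forall>M. f M \<noteq> 0 \<longrightarrow> size M \<le> d) \<and> (\<forall>\<pi> M. bij \<pi> \<longrightarrow> f (image_mset \<pi> M) = f M)"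
    and "(\<exists>d. \<forall>M. g M \<noteq> 0 \<longrightarrow> size M \<le> d) \<and> (\<forall>\<pi> M. bij \<pi> \<longrightarrow> g (image_mset \<pi> M) = g M)"
  then obtain d e where de: "\<forall>M. f M \<noteq> 0 \<longrightarrow> size M \<le> d" "\<forall>M. g M \<noteq> 0 \<longrightarrow> size M \<le> e" by blast
  have "size M \<le> max d e" if "f M + g M \<noteq> 0" for M
    using de that by (cases "f M = 0") (auto simp: le_max_iff_disj)
  thus "\<exists>d. \<forall>M. f M + g M \<noteq> 0 \<longrightarrow> size M \<le> d" by blast
qed auto

lift_definition uminus_symfun :: "symfun \<Rightarrow> symfun" is "\<lambda>f M. - f M" by auto

definition minus_symfun :: "symfun \<Rightarrow> symfun \<Rightarrow> symfun" where "minus_symfun f g = f + - g"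

lift_definition times_symfun :: "symfun \<Rightarrow> symfun \<Rightarrow> symfun" is sf_conv
proof (intro conjI allI impI)
  fix f g :: "nat multiset \<Rightarrow> rat"
  assume f: "(\<exists>d. \<forall>M. f M \<noteq> 0 \<longrightarrow> size M \<le> d) \<and> (\<forall>\<pi> M. bij \<pi> \<longrightarrow> f (image_mset \<pi> M) = f M)"
    and g: "(\<exists>d. \<forall>M. g M \<noteq> 0 \<longrightarrow> size M \<le> d) \<and> (\<forall>\<pi> M. bij \<pi> \<longrightarrow> g (image_mset \<pi> M) = g M)"
  from f g obtain d e where "\<forall>M. f M \<noteq> 0 \<longrightarrow> size M \<le> d" "\<forall>M. g M \<noteq> 0 \<longrightarrow> size M \<le> e"
    by blast
  thus "\<exists>d. \<forall>M. sf_conv f g M \<noteq> 0 \<longrightarrow> size M \<le> d"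
    using sf_conv_bounded by (intro exI[of _ "d + e"]) simp
  fix \<pi> :: "nat \<Rightarrow> nat" and M assume "bij \<pi>"
  thus "sf_conv f g (image_mset \<pi> M) = sf_conv f g M"
    using f g by (intro sf_conv_image_mset) simp_all
qed

instance
proof
  fix f g h :: symfun
  show "f * g * h = f * (g * h)" by transfer (rule ext, rule sf_conv_assoc)
  show "f * g = g * f" by transfer (rule ext, rule sf_conv_commute)
  show "1 * f = f"
  proof transfer
    fix f :: "nat multiset \<Rightarrow> rat"
    have "sf_conv (\<lambda>M. if M = {#} then 1 else 0) f M = (\<Sum>A\<in>{{#}}. f (M - A))" for M
      unfolding sf_conv_def by (rule sum.mono_neutral_cong_right) (auto simp: finite_submultisets)
    thus "sf_conv (\<lambda>M. if M = {#} then 1 else 0) f = f" by auto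
  qed
  show "(f + g) * h = f * h + g * h"
    by transfer (simp add: fun_eq_iff sf_conv_def distrib_right sum.distrib)
  show "(0 :: symfun) \<noteq> 1" by transfer (auto simp: fun_eq_iff)
  show "f + g + h = f + (g + h)" "f + g = g + f" "0 + f = f" "- f + f = 0"
    by (transfer; simp add: fun_eq_iff)+
  show "f - g = f + - g" by (rule minus_symfun_def)
qed

end

lift_definition sf_scale :: "rat \<Rightarrow> symfun \<Rightarrow> symfun" is "\<lambda>c f M. c * f M" by auto

interpretation sf: vector_space sf_scale
  by unfold_locales (transfer; simp add: fun_eq_iff algebra_simps)+

text \<open>The ideal generated by a set is its span in the ring as a module over itself.\<close>

interpretation sf_ideal: module "(*) :: symfun \<Rightarrow> symfun \<Rightarrow> symfun"
  by unfold_locales (simp_all add: algebra_simps)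

definition sf_homogeneous :: "nat \<Rightarrow> symfun set" where
  "sf_homogeneous n = {f. \<forall>M. sf_coeff f M \<noteq> 0 \<longrightarrow> size M = n}"

lift_definition hsym :: "nat \<Rightarrow> symfun" is "\<lambda>r M. if size M = r then 1 else 0" by auto

text \<open>The power sum \<open>\<Sum>\<^sub>i z\<^sub>i\<^sup>m\<close>, meaningful for \<open>m \<ge> 1\<close> only.\<close>

lift_definition psym :: "nat \<Rightarrow> symfun" is "\<lambda>m M. if \<exists>i. M = replicate_mset m i then 1 else 0"
proof (intro conjI)
  fix m :: nat
  show "\<exists>d. \<forall>M. (if \<exists>i :: nat. M = replicate_mset m i then 1 else 0 :: rat) \<noteq> 0 \<longrightarrow> size M \<le> d"
    by (rule exI[of _ m]) auto
  have "(\<exists>i. image_mset \<pi> M = replicate_mset m i) \<longleftrightarrow> (\<exists>i. M = replicate_mset m i)"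
    if "bij \<pi>" for \<pi> :: "nat \<Rightarrow> nat" and M
  proof
    assume "\<exists>i. image_mset \<pi> M = replicate_mset m i"
    then obtain i where "image_mset \<pi> M = replicate_mset m i" by blast
    hence "image_mset (inv \<pi>) (image_mset \<pi> M) = replicate_mset m (inv \<pi> i)" by simp
    thus "\<exists>i. M = replicate_mset m i"
      using that by (auto simp: multiset.map_comp bij_is_inj inv_o_cancel)
  qed auto
  thus "\<forall>(\<pi> :: nat \<Rightarrow> nat) M. bij \<pi> \<longrightarrow> (if \<exists>i. image_mset \<pi> M = replicate_mset m i then 1 else 0 :: rat)
      = (if \<exists>i. M = replicate_mset m i then 1 else 0)"
    by (intro allI impI if_cong refl) blast
qed

text \<open>Partitions are encoded as multisets of positive parts; the length is the size.\<close>

definition partitions :: "nat \<Rightarrow> nat multiset set" where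
  "partitions n = {\<mu>. 0 \<notin># \<mu> \<and> sum_mset \<mu> = n}"

definition psym_part :: "nat multiset \<Rightarrow> symfun" where
  "psym_part \<mu> = prod_mset (image_mset psym \<mu>)"

text \<open>\<open>\<rat>[x,y]\<close> is represented as \<open>\<rat>[x][y]\<close>, so that \<open>pderiv\<close> is \<open>\<partial>\<^sub>y\<close> and
  \<open>map_poly pderiv\<close> is \<open>\<partial>\<^sub>x\<close>; scalars are constant polynomials.\<close>

type_synonym qxy = "rat poly poly"

definition xvar :: qxy where "xvar = [:[:0, 1:]:]"
definition yvar :: qxy where "yvar = [:0, 1:]"

definition qxy_const :: "rat \<Rightarrow> qxy" where "qxy_const c = [:[:c:]:]"
definition qxy_scale :: "rat \<Rightarrow> qxy \<Rightarrow> qxy" where "qxy_scale c f = qxy_const c * f"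

interpretation qxy: vector_space qxy_scale
proof -
  have *: "qxy_const (a + b) = qxy_const a + qxy_const b"
    "qxy_const (a * b) = qxy_const a * qxy_const b" "qxy_const 1 = 1" for a b
    by (simp_all add: qxy_const_def one_pCons)
  show "vector_space qxy_scale"
    by unfold_locales (simp_all add: qxy_scale_def * algebra_simps)
qed

typedef qxy_end = "{T :: qxy \<Rightarrow> qxy. Vector_Spaces.linear qxy_scale qxy_scale T}"
  morphisms app Abs_qxy_end
  using qxy.linear_id by blast

setup_lifting type_definition_qxy_end

lemma qxy_linear_iff:
  "Vector_Spaces.linear qxy_scale qxy_scale T \<longleftrightarrow>
     (\<forall>f g. T (f + g) = T f + T g) \<and> (\<forall>c f. T (qxy_scale c f) = qxy_scale c (T f))"
  using qxy.vector_space_axioms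
  by (auto simp: Vector_Spaces.linear_def module_hom_def module_hom_axioms_def qxy.module_axioms)

instantiation qxy_end :: ring_1
begin

lift_definition zero_qxy_end :: qxy_end is "\<lambda>_. 0"
  by (auto simp: qxy_linear_iff)
lift_definition one_qxy_end :: qxy_end is "\<lambda>f. f"
  by (auto simp: qxy_linear_iff)
lift_definition plus_qxy_end :: "qxy_end \<Rightarrow> qxy_end \<Rightarrow> qxy_end" is "\<lambda>S T f. S f + T f"
  by (simp add: qxy_linear_iff qxy.scale_right_distrib add_ac)
lift_definition uminus_qxy_end :: "qxy_end \<Rightarrow> qxy_end" is "\<lambda>T f. - T f"
  by (auto simp: qxy_linear_iff)
lift_definition minus_qxy_end :: "qxy_end \<Rightarrow> qxy_end \<Rightarrow> qxy_end" is "\<lambda>S T f. S f - T f"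
  by (simp add: qxy_linear_iff qxy.scale_right_diff_distrib)
lift_definition times_qxy_end :: "qxy_end \<Rightarrow> qxy_end \<Rightarrow> qxy_end" is "\<lambda>S T f. S (T f)"
  by (auto simp: qxy_linear_iff)

instance
proof
  fix S T U :: qxy_end
  show "S * T * U = S * (T * U)" by transfer simp
  show "1 * T = T" "T * 1 = T" by (transfer; simp)+
  show "(S + T) * U = S * U + T * U" by transfer simp
  show "S * (T + U) = S * T + S * U"
    by transfer (simp only: qxy_linear_iff simp_thms)
  show "S + T + U = S + (T + U)" by transfer (simp only: add.assoc)
  show "S + T = T + S" by transfer (simp only: add.commute)
  show "0 + T = T" "- T + T = 0" "S - T = S + - T" by (transfer; simp)+
  show "(0 :: qxy_end) \<noteq> 1"
  proof transfer
    show "(\<lambda>_ :: qxy. 0 :: qxy) \<noteq> (\<lambda>f. f)"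
      using fun_cong[of "\<lambda>_ :: qxy. 0 :: qxy" "\<lambda>f. f" 1] by auto
  qed
qed

end

lift_definition end_scale :: "rat \<Rightarrow> qxy_end \<Rightarrow> qxy_end" is "\<lambda>c T f. qxy_scale c (T f)"
  by (simp add: qxy_linear_iff qxy_scale_def distrib_left mult.left_commute)

interpretation endo: vector_space end_scale
  by unfold_locales
     (transfer; simp add: fun_eq_iff qxy.scale_right_distrib qxy.scale_left_distrib)+

definition mult_op :: "qxy \<Rightarrow> qxy_end" where
  "mult_op g = Abs_qxy_end (\<lambda>f. g * f)"

lemma app_mult_op: "app (mult_op g) f = g * f"
  unfolding mult_op_def
  by (subst Abs_qxy_end_inverse) (simp_all add: qxy_linear_iff qxy_scale_def distrib_left mult.left_commute)

lift_definition D_op :: qxy_end is "\<lambda>f. map_poly pderiv f + pderiv f"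
proof -
  have "map_poly pderiv (f + g) = map_poly pderiv f + map_poly pderiv (g :: qxy)" for f g
    by (rule poly_eqI) (simp add: coeff_map_poly pderiv_add)
  moreover have "map_poly pderiv (qxy_scale c f) = qxy_scale c (map_poly pderiv f)" for c f
    by (rule poly_eqI) (simp add: qxy_scale_def qxy_const_def coeff_map_poly pderiv_smult)
  moreover have "pderiv (qxy_scale c f) = qxy_scale c (pderiv f)" for c f
    by (simp add: qxy_scale_def qxy_const_def pderiv_smult)
  ultimately show ?thesis
    by (simp add: qxy_linear_iff pderiv_add qxy.scale_right_distrib add_ac)
qed

definition G_op :: "nat \<Rightarrow> qxy_end" where
  "G_op r = (if r = 0 then 1
          else mult_op (yvar ^ r) *
            (\<Sum>j = 1..r. end_scale (of_nat ((r - 1) choose (j - 1)) / fact j) (mult_op (xvar ^ j) * D_op ^ j)))"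

definition unital_alg_hom :: "(symfun \<Rightarrow> qxy_end) \<Rightarrow> bool" where
  "unital_alg_hom \<phi> \<longleftrightarrow>
     Vector_Spaces.linear sf_scale end_scale \<phi> \<and> \<phi> 1 = 1 \<and> (\<forall>f g. \<phi> (f * g) = \<phi> f * \<phi> g)"

definition \<rho> :: "symfun \<Rightarrow> qxy_end" where
  "\<rho> = (THE \<phi>. unital_alg_hom \<phi> \<and> (\<forall>r\<ge>1. \<phi> (hsym r) = G_op r))"

definition \<delta> :: qxy where "\<delta> = yvar - xvar"

definition u_frac :: "qxy fract" where "u_frac = to_fract xvar / to_fract yvar"

definition Q_derivation :: "(qxy fract \<Rightarrow> qxy fract) \<Rightarrow> bool" where
  "Q_derivation d \<longleftrightarrow>
     (\<forall>a b. d (a + b) = d a + d b) \<and>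
     (\<forall>c a. d (to_fract (qxy_const c) * a) = to_fract (qxy_const c) * d a) \<and>
     (\<forall>a b. d (a * b) = a * d b + d a * b)"

definition E_op :: "qxy fract \<Rightarrow> qxy fract" where
  "E_op = (THE d. Q_derivation d \<and> d (to_fract \<delta>) = 0 \<and> d u_frac = u_frac)"

text \<open>The endomorphism of \<open>\<rat>[x,y]\<close> obtained by restricting \<open>\<delta>\<^sup>n E\<^sup>l\<close>, an operator on
  \<open>\<rat>(x,y)\<close>, provided that it maps \<open>\<rat>[x,y]\<close> to itself (as it does for \<open>1 \<le> l \<le> n\<close>).\<close>

definition \<delta>E :: "nat \<Rightarrow> nat \<Rightarrow> qxy_end" where
  "\<delta>E n l = (THE T. \<forall>f. to_fract (app T f) = to_fract \<delta> ^ n * (E_op ^^ l) (to_fract f))"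

end

theory Submission
  imports Defs "HOL-Combinatorics.Transposition"
begin

text \<open>
  The power sum products \<open>p\<^sub>\<mu>\<close> form a basis of \<open>\<Lambda>\<close>: if \<open>p\<^sub>\<mu>\<close> contains a monomial in
  \<open>k\<close> variables then \<open>k \<le> \<ell>(\<mu>)\<close>, with equality only if its exponents are the parts of \<open>\<mu>\<close>,
  so the transition to monomials is triangular. The operators satisfy
  \<open>n \<G>\<^sub>n = \<Sum>\<^sub>i \<delta>\<^sup>i E \<G>\<^bsub>n-i\<^esub>\<close>, as one sees on \<open>x\<^sup>b\<close>, where
  \<open>\<G>\<^sub>r x\<^sup>b = binom (b + r - 1) r y\<^sup>r x\<^sup>b\<close>; everything commutes with \<open>\<delta>\<close>. Comparison with
  Newton's identity \<open>n h\<^sub>n = \<Sum>\<^sub>i p\<^sub>i h\<^bsub>n-i\<^esub>\<close> gives \<open>\<rho>(p\<^sub>m) = \<delta>\<^sup>m E\<close>.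

  Modulo the ideal, \<open>p\<^sub>\<mu>\<close> depends only on the size \<open>n\<close> and length \<open>l\<close> of \<open>\<mu>\<close>: it is congruent
  to \<open>p\<^sub>\<nu>\<close> for the hook \<open>\<nu> = (n - l + 1, 1, \<dots>, 1)\<close>. The images \<open>\<delta>\<^sup>n E\<^sup>l\<close> of the hooks are linearly
  independent because \<open>\<delta>\<^sup>n E\<^sup>l x\<^sup>b\<close> is congruent to \<open>b\<^sup>l x\<^sup>b y\<^sup>n\<close> modulo \<open>x\<^bsup>b+1\<^esup>\<close>. Hence the
  ideal is the whole kernel, and the differences \<open>p\<^sub>\<mu> - p\<^sub>\<nu>\<close> for non-hooks \<open>\<mu>\<close> are a basis of it.
\<close>

section \<open>Power sums as a basis of the ring of symmetric functions\<close>

lemma sf_coeff_zero [simp]: "sf_coeff 0 M = 0"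
  by (simp add: zero_symfun.rep_eq)

lemma sf_coeff_one: "sf_coeff 1 M = (if M = {#} then 1 else 0)"
  by (simp add: one_symfun.rep_eq)

lemma sf_coeff_add [simp]: "sf_coeff (f + g) M = sf_coeff f M + sf_coeff g M"
  by (simp add: plus_symfun.rep_eq)

lemma sf_coeff_diff [simp]: "sf_coeff (f - g) M = sf_coeff f M - sf_coeff g M"
  by (simp only: minus_symfun_def plus_symfun.rep_eq uminus_symfun.rep_eq diff_conv_add_uminus)

lemma sf_coeff_scale [simp]: "sf_coeff (sf_scale c f) M = c * sf_coeff f M"
  by (simp add: sf_scale.rep_eq)

lemma sf_coeff_sum: "sf_coeff (sum f S) M = (\<Sum>i\<in>S. sf_coeff (f i) M)"
  by (induction S rule: infinite_finite_induct) auto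

lemma symfun_eqI: "(\<And>M. sf_coeff f M = sf_coeff g M) \<Longrightarrow> f = g"
  by (metis sf_coeff_inject ext)

lemma sf_coeff_image_mset: "bij \<pi> \<Longrightarrow> sf_coeff f (image_mset \<pi> M) = sf_coeff f M"
  using sf_coeff[of f] by blast

lemma sf_scale_mult_left: "sf_scale c f * g = sf_scale c (f * g)"
  by (rule symfun_eqI) (simp add: times_symfun.rep_eq sf_conv_def sum_distrib_left mult.assoc)

lemma sf_scale_mult_right: "f * sf_scale c g = sf_scale c (f * g)"
  by (metis sf_scale_mult_left mult.commute)

lemma sf_scale_conv_mult: "sf_scale c f = sf_scale c 1 * f"
  by (simp add: sf_scale_mult_left)

lemma sf_scale_of_nat: "sf_scale (of_nat n) f = of_nat n * f"
  by (induction n) (simp_all add: sf.scale_left_distrib distrib_right)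

lemma sf_coeff_of_nat_mult: "sf_coeff (of_nat n * f) M = of_nat n * sf_coeff f M"
  by (simp flip: sf_scale_of_nat)

lemma hsym_0: "hsym 0 = 1"
  by (rule symfun_eqI) (simp add: hsym.rep_eq sf_coeff_one)

text \<open>Only submultisets of the form z_i^m contribute to the convolution. For m >= 1 they are
  distinct for distinct i, so the sum may run over the variables instead.\<close>

lemma sf_coeff_psym_mult:
  assumes "m \<ge> 1"
  shows "sf_coeff (psym m * f) M = (\<Sum>i | m \<le> count M i. sf_coeff f (M - replicate_mset m i))"
proof -
  have inj: "inj (replicate_mset m :: nat \<Rightarrow> _)"
    using assms by (auto simp: inj_def replicate_mset_eq_iff)
  have "sf_coeff (psym m * f) M = (\<Sum>A | A \<subseteq># M. sf_coeff (psym m) A * sf_coeff f (M - A))"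
    by (simp add: times_symfun.rep_eq sf_conv_def)
  also have "\<dots> = (\<Sum>A\<in>replicate_mset m ` {i. m \<le> count M i}. sf_coeff f (M - A))"
    by (rule sum.mono_neutral_cong_right)
       (auto simp: finite_submultisets psym.rep_eq count_le_replicate_mset_subset_eq)
  also have "\<dots> = (\<Sum>i | m \<le> count M i. sf_coeff f (M - replicate_mset m i))"
    by (subst sum.reindex) (use inj in \<open>auto simp: inj_on_def\<close>)
  finally show ?thesis .
qed

text \<open>Double counting: on a monomial M of degree n the right side counts the pairs (i, v) with
  1 <= i <= \<open>count M v\<close>. Each variable v contributes its exponent, and the exponents
  add up to n.\<close>

lemma newton_identity:
  "of_nat n * hsym n = (\<Sum>i = 1..n. psym i * hsym (n - i))"
proof (rule symfun_eqI)
  fix M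
  have "(\<Sum>i = 1..n. sf_coeff (psym i * hsym (n - i)) M) =
      (\<Sum>i = 1..n. \<Sum>v | v \<in> set_mset M \<and> i \<le> count M v. if size M = n then 1 else 0)"
  proof (rule sum.cong[OF refl])
    fix i assume i: "i \<in> {1..n}"
    have "{v. i \<le> count M v} = {v. v \<in> set_mset M \<and> i \<le> count M v}"
      using i by (auto simp flip: count_greater_zero_iff)
    moreover have "sf_coeff (hsym (n - i)) (M - replicate_mset i v) = (if size M = n then 1 else 0)"
      if "i \<le> count M v" for v
    proof -
      have "size (M - replicate_mset i v) = size M - i" "i \<le> size M"
        using that size_mset_mono[of "replicate_mset i v" M]
        by (simp_all add: count_le_replicate_mset_subset_eq size_Diff_submset)
      thus ?thesis using i by (auto simp: hsym.rep_eq)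
    qed
    ultimately show "sf_coeff (psym i * hsym (n - i)) M =
        (\<Sum>v | v \<in> set_mset M \<and> i \<le> count M v. if size M = n then 1 else 0)"
      using i by (simp add: sf_coeff_psym_mult)
  qed
  also have "\<dots> = (\<Sum>v\<in>set_mset M. \<Sum>i | i \<in> {1..n} \<and> i \<le> count M v. if size M = n then 1 else 0)"
    by (rule sum.swap_restrict) simp_all
  also have "\<dots> = (\<Sum>v\<in>set_mset M. if size M = n then of_nat (count M v) else 0)"
  proof (rule sum.cong[OF refl])
    fix v
    have "{i. i \<in> {1..n} \<and> i \<le> count M v} = {1..count M v}" if "size M = n"
      using that count_le_size[of M v] by auto
    thus "(\<Sum>i | i \<in> {1..n} \<and> i \<le> count M v. if size M = n then 1 else 0) =
        (if size M = n then of_nat (count M v) else (0 :: rat))" by auto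
  qed
  also have "\<dots> = (if size M = n then of_nat n else 0)"
    by (auto simp: size_multiset_overloaded_eq)
  finally show "sf_coeff (of_nat n * hsym n) M = sf_coeff (\<Sum>i = 1..n. psym i * hsym (n - i)) M"
    by (simp add: sf_coeff_of_nat_mult hsym.rep_eq sf_coeff_sum)
qed

section \<open>Exponent partitions as orbit invariants of monomials\<close>

definition exponents :: "nat multiset \<Rightarrow> nat multiset" where
  "exponents M = image_mset (count M) (mset_set (set_mset M))"

lemma size_exponents: "size (exponents M) = card (set_mset M)"
  by (simp add: exponents_def)

lemma zero_notin_exponents: "0 \<notin># exponents M"
  by (auto simp: exponents_def count_eq_zero_iff)

lemma sum_mset_exponents: "sum_mset (exponents M) = size M"
  by (simp add: exponents_def size_multiset_overloaded_eq sum_unfold_sum_mset)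

lemma exponents_empty [simp]: "exponents {#} = {#}"
  by (simp add: exponents_def)

lemma exponents_add_new:
  assumes "m \<ge> 1" "i \<notin># M"
  shows "exponents (replicate_mset m i + M) = add_mset m (exponents M)"
proof -
  have "set_mset (replicate_mset m i + M) = insert i (set_mset M)" using assms by auto
  moreover have "count M i = 0" using assms by (simp add: not_in_iff)
  moreover have "image_mset (count (replicate_mset m i + M)) (mset_set (set_mset M)) =
      image_mset (count M) (mset_set (set_mset M))"
    using assms by (intro image_mset_cong) auto
  ultimately show ?thesis using assms by (simp add: exponents_def)
qed

lemma exponents_eq_add_msetE:
  assumes "exponents M = add_mset m \<mu>"
  obtains i N where "M = replicate_mset m i + N" "i \<notin># N" "exponents N = \<mu>" "m \<ge> 1"
proof -
  have "m \<in># exponents M" using assms by simp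
  then obtain i where i: "i \<in># M" "count M i = m" by (auto simp: exponents_def)
  define N where "N = M - replicate_mset m i"
  have M: "M = replicate_mset m i + N" and N: "i \<notin># N" and m: "m \<ge> 1"
    using i by (auto simp: N_def not_in_iff Suc_le_eq
        simp flip: count_greater_zero_iff count_le_replicate_mset_subset_eq
        intro!: subset_mset.add_diff_inverse[symmetric])
  moreover have "exponents N = \<mu>"
    using exponents_add_new[OF m N] assms M by simp
  ultimately show ?thesis using that by blast
qed

lemma exists_exponents:
  assumes "0 \<notin># \<mu>"
  shows "\<exists>M. exponents M = \<mu>"
  using assms
proof (induction \<mu>)
  case empty
  show ?case by (intro exI[of _ "{#}"]) simp
next
  case (add m \<mu>)
  then obtain M where M: "exponents M = \<mu>" by auto
  obtain i where "i \<notin># M"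
    using ex_new_if_finite[of "set_mset M"] by auto
  with add.prems M show ?case
    by (intro exI[of _ "replicate_mset m i + M"]) (auto simp: exponents_add_new Suc_le_eq)
qed

text \<open>Induction on the number of variables: a variable with the same exponent is split off
  from each monomial. Hence a symmetric function has one coefficient per partition.\<close>

lemma exponents_eq_imp_permutation:
  assumes "exponents M = exponents N"
  shows "\<exists>\<pi>. bij \<pi> \<and> image_mset \<pi> M = N"
  using assms
proof (induction "exponents M" arbitrary: M N)
  case empty
  have "M = {#}" "N = {#}"
    using size_exponents[of M] size_exponents[of N] empty by auto
  thus ?case by (intro exI[of _ id] conjI bij_id) simp
next
  case (add m \<mu>)
  obtain i M' where M: "M = replicate_mset m i + M'" "i \<notin># M'" "exponents M' = \<mu>" "m \<ge> 1"
    using add.hyps(2) by (metis exponents_eq_add_msetE)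
  obtain j N' where N: "N = replicate_mset m j + N'" "j \<notin># N'" "exponents N' = \<mu>"
    using add.hyps(2) add.prems by (metis exponents_eq_add_msetE)
  obtain \<pi> where \<pi>: "bij \<pi>" "image_mset \<pi> M' = N'"
    using add.hyps(1)[of M' N'] M N by auto
  \<comment> \<open>\<open>\<pi>\<close> matches the remaining variables but need not send i to j.
    The transposition corrects this and fixes N', in which neither \<open>\<pi> i\<close> nor j
    occurs.\<close>
  define \<tau> where "\<tau> = transpose (\<pi> i) j"
  have "\<pi> i \<notin># N'"
    using M(2) \<pi>(1) by (auto simp: inj_image_mem_iff bij_is_inj simp flip: \<pi>(2))
  hence "image_mset \<tau> N' = image_mset id N'"
    using N(2) by (intro image_mset_cong) (auto simp: \<tau>_def transpose_def)
  hence "image_mset (\<tau> \<circ> \<pi>) M = N"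
    using M(1) N(1) \<pi>(2) by (simp add: \<tau>_def flip: multiset.map_comp)
  moreover have "bij (\<tau> \<circ> \<pi>)"
    using \<pi>(1) by (auto simp: \<tau>_def intro: bij_comp)
  ultimately show ?case by blast
qed

lemma sf_coeff_eq_if_exponents_eq:
  "exponents M = exponents N \<Longrightarrow> sf_coeff f M = sf_coeff f N"
  by (metis exponents_eq_imp_permutation sf_coeff_image_mset)

section \<open>Triangularity of the power sum products\<close>

lemma psym_part_empty [simp]: "psym_part {#} = 1"
  and psym_part_add_mset [simp]: "psym_part (add_mset m \<mu>) = psym m * psym_part \<mu>"
  and psym_part_union: "psym_part (\<mu> + \<nu>) = psym_part \<mu> * psym_part \<nu>"
  by (simp_all add: psym_part_def)

text \<open>Nonnegativity excludes cancellation, so one positive term suffices for the diagonal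
  entries below to be positive.\<close>

lemma sf_coeff_psym_part_nonneg:
  "0 \<notin># \<mu> \<Longrightarrow> sf_coeff (psym_part \<mu>) M \<ge> 0"
  by (induction \<mu> arbitrary: M)
     (auto simp: sf_coeff_one Suc_le_eq sf_coeff_psym_mult intro!: sum_nonneg)

lemma sf_coeff_psym_part_exponents:
  assumes "0 \<notin># \<mu>" "exponents M = \<mu>"
  shows "sf_coeff (psym_part \<mu>) M > 0"
  using assms
proof (induction \<mu> arbitrary: M)
  case empty
  hence "M = {#}" using size_exponents[of M] by auto
  thus ?case by (simp add: sf_coeff_one)
next
  case (add m \<mu>)
  obtain i N where N: "M = replicate_mset m i + N" "i \<notin># N" "exponents N = \<mu>" "m \<ge> 1"
    using add.prems(2) by (rule exponents_eq_add_msetE)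
  have fin: "finite {i. m \<le> count M i}"
    by (rule finite_subset[of _ "set_mset M"]) (use N(4) in \<open>auto simp flip: count_greater_zero_iff\<close>)
  have "0 < (\<Sum>i | m \<le> count M i. sf_coeff (psym_part \<mu>) (M - replicate_mset m i))"
    by (rule sum_pos2[OF fin, of i]) (use N add in \<open>auto simp: sf_coeff_psym_part_nonneg\<close>)
  thus ?case using N(4) by (simp add: sf_coeff_psym_mult)
qed

text \<open>Multiplication by p_m introduces at most one new variable. If the number of variables
  equals the number of factors, every factor has introduced its own, and the exponents are the
  parts.\<close>

lemma sf_coeff_psym_part_nonzeroD:
  assumes "0 \<notin># \<mu>" "sf_coeff (psym_part \<mu>) M \<noteq> 0"
  shows "size M = sum_mset \<mu>"
    and "card (set_mset M) \<le> size \<mu>"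
    and "card (set_mset M) = size \<mu> \<Longrightarrow> exponents M = \<mu>"
proof -
  have "size M = sum_mset \<mu> \<and> card (set_mset M) \<le> size \<mu> \<and>
      (card (set_mset M) = size \<mu> \<longrightarrow> exponents M = \<mu>)"
    using assms
  proof (induction \<mu> arbitrary: M)
    case empty
    thus ?case by (auto simp: sf_coeff_one split: if_splits)
  next
    case (add m \<mu>)
    hence m: "m \<ge> 1" by (simp add: Suc_le_eq)
    with add.prems obtain i where i: "m \<le> count M i"
        "sf_coeff (psym_part \<mu>) (M - replicate_mset m i) \<noteq> 0"
      by (auto simp: sf_coeff_psym_mult elim: sum.not_neutral_contains_not_neutral)
    define N where "N = M - replicate_mset m i"
    have M: "M = replicate_mset m i + N"
      using i(1) by (simp add: N_def count_le_replicate_mset_subset_eq)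
    have IH: "size N = sum_mset \<mu>" "card (set_mset N) \<le> size \<mu>"
        "card (set_mset N) = size \<mu> \<Longrightarrow> exponents N = \<mu>"
      using add.IH[of N] add.prems i(2) by (auto simp: N_def)
    have card: "card (set_mset M) = (if i \<in># N then card (set_mset N) else Suc (card (set_mset N)))"
      using M m by (auto simp: insert_absorb)
    have "exponents M = add_mset m \<mu>" if "card (set_mset M) = Suc (size \<mu>)"
      using that card IH exponents_add_new[OF m, of i N] M by (auto split: if_splits)
    thus ?case using M IH card by auto
  qed
  thus "size M = sum_mset \<mu>" "card (set_mset M) \<le> size \<mu>"
    "card (set_mset M) = size \<mu> \<Longrightarrow> exponents M = \<mu>" by auto
qed

text \<open>Among the partitions with nonzero coefficient take a longest one, \<nu>. By
  triangularity a monomial with exponents \<nu> occurs in no other term of the relation, so nothing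
  cancels it.\<close>

lemma sum_psym_part_eq_0D:
  assumes "finite S" "\<And>\<mu>. \<mu> \<in> S \<Longrightarrow> 0 \<notin># \<mu>"
    and "(\<Sum>\<mu>\<in>S. sf_scale (c \<mu>) (psym_part \<mu>)) = 0" "\<mu> \<in> S"
  shows "c \<mu> = 0"
proof (rule ccontr)
  assume "c \<mu> \<noteq> 0"
  define S' where "S' = {\<mu> \<in> S. c \<mu> \<noteq> 0}"
  have S': "finite S'" "S' \<noteq> {}" using assms(1,4) \<open>c \<mu> \<noteq> 0\<close> by (auto simp: S'_def)
  then obtain \<nu> where \<nu>: "\<nu> \<in> S'" "\<And>\<mu>. \<mu> \<in> S' \<Longrightarrow> size \<mu> \<le> size \<nu>"
    using Max_in[of "size ` S'"] Max_ge[of "size ` S'"] by (metis (no_types) finite_imageI image_iff image_is_empty)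
  have S: "\<nu> \<in> S" "c \<nu> \<noteq> 0" "0 \<notin># \<nu>" using \<nu>(1) assms(2) by (auto simp: S'_def)
  obtain M where M: "exponents M = \<nu>" using exists_exponents S(3) by blast
  have "0 = sf_coeff (\<Sum>\<mu>\<in>S. sf_scale (c \<mu>) (psym_part \<mu>)) M" using assms(3) by simp
  also have "\<dots> = (\<Sum>\<mu>\<in>S. c \<mu> * sf_coeff (psym_part \<mu>) M)"
    by (simp add: sf_coeff_sum)
  also have "\<dots> = (\<Sum>\<mu>\<in>{\<nu>}. c \<mu> * sf_coeff (psym_part \<mu>) M)"
  proof (rule sum.mono_neutral_right)
    show "\<forall>\<mu>\<in>S - {\<nu>}. c \<mu> * sf_coeff (psym_part \<mu>) M = 0"
    proof (rule ballI, rule ccontr)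
      fix \<mu> assume \<mu>: "\<mu> \<in> S - {\<nu>}" "c \<mu> * sf_coeff (psym_part \<mu>) M \<noteq> 0"
      hence "size \<mu> \<le> size \<nu>" using \<nu>(2) by (auto simp: S'_def)
      moreover have "0 \<notin># \<mu>" using \<mu> assms(2) by auto
      ultimately have "exponents M = \<mu>"
        using sf_coeff_psym_part_nonzeroD[of \<mu> M] \<mu> size_exponents[of M] M by auto
      thus False using M \<mu> by auto
    qed
  qed (use assms S in auto)
  finally show False using S sf_coeff_psym_part_exponents[OF S(3) M] by simp
qed

section \<open>The power sum basis of the ring and of its homogeneous components\<close>

definition parts :: "nat multiset set" where
  "parts = {\<mu>. 0 \<notin># \<mu>}"

lemma inj_on_psym_part: "inj_on psym_part parts"
proof (rule inj_onI, rule ccontr)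
  fix \<mu> \<nu> assume *: "\<mu> \<in> parts" "\<nu> \<in> parts" "psym_part \<mu> = psym_part \<nu>" "\<mu> \<noteq> \<nu>"
  have "(if \<mu> = \<mu> then 1 else - 1 :: rat) = 0"
    by (rule sum_psym_part_eq_0D[of "{\<mu>, \<nu>}" "\<lambda>\<kappa>. if \<kappa> = \<mu> then 1 else -1" \<mu>])
       (use * in \<open>auto simp: parts_def\<close>)
  thus False by simp
qed

lemma independent_psym_part: "sf.independent (psym_part ` parts)"
  unfolding sf.independent_explicit_finite_subsets
proof (intro allI impI ballI)
  fix A u f
  assume A: "A \<subseteq> psym_part ` parts" "finite A" "(\<Sum>v\<in>A. sf_scale (u v) v) = 0" "f \<in> A"
  obtain S where S: "S \<subseteq> parts" "A = psym_part ` S" by (metis A(1) subset_imageE)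
  have inj: "inj_on psym_part S" using inj_on_psym_part S(1) inj_on_subset by blast
  have "finite S" using A(2) S(2) inj by (simp add: finite_image_iff)
  moreover have "(\<Sum>\<mu>\<in>S. sf_scale (u (psym_part \<mu>)) (psym_part \<mu>)) = 0"
    using A(3) S(2) inj by (simp add: sum.reindex)
  ultimately show "u f = 0"
    using sum_psym_part_eq_0D[of S "u \<circ> psym_part"] S A(4) by (auto simp: parts_def)
qed

lemma finite_partitions: "finite (partitions n)"
proof (rule finite_subset)
  have "size \<mu> \<le> sum_mset \<mu>" if "0 \<notin># \<mu>" for \<mu> :: "nat multiset"
    using that by (induction \<mu>) auto
  moreover have "x \<le> sum_mset \<mu>" if "x \<in># \<mu>" for x and \<mu> :: "nat multiset"
    using that by (auto dest: multi_member_split)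
  ultimately show "partitions n \<subseteq> (\<Union>k\<le>n. {\<mu>. set_mset \<mu> \<subseteq> {..n} \<and> size \<mu> = k})"
    by (auto simp: partitions_def)
  have "{\<mu> :: nat multiset. set_mset \<mu> \<subseteq> {..n} \<and> size \<mu> = k} \<subseteq>
      mset ` {xs. set xs \<subseteq> {..n} \<and> length xs = k}" for k
  proof
    fix \<mu> :: "nat multiset" assume "\<mu> \<in> {\<mu>. set_mset \<mu> \<subseteq> {..n} \<and> size \<mu> = k}"
    moreover obtain xs where "mset xs = \<mu>" using ex_mset by blast
    ultimately show "\<mu> \<in> mset ` {xs. set xs \<subseteq> {..n} \<and> length xs = k}" by auto
  qed
  hence "finite {\<mu> :: nat multiset. set_mset \<mu> \<subseteq> {..n} \<and> size \<mu> = k}" for k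
    by (rule finite_subset) (intro finite_imageI finite_lists_length_eq finite_atMost)
  thus "finite (\<Union>k\<le>n. {\<mu> :: nat multiset. set_mset \<mu> \<subseteq> {..n} \<and> size \<mu> = k})"
    by blast
qed

text \<open>The \<open>p\<^sub>\<mu>\<close> with \<open>k\<close> parts serve to clear the coefficients of all monomials in exactly
  \<open>k\<close> variables.\<close>

lemma in_span_psym_part:
  assumes "finite I" "\<And>M. sf_coeff f M \<noteq> 0 \<Longrightarrow> size M \<in> I"
    and "\<And>M. sf_coeff f M \<noteq> 0 \<Longrightarrow> card (set_mset M) \<le> k"
  shows "f \<in> sf.span (psym_part ` (\<Union>n\<in>I. partitions n))"
  using assms(2,3)
proof (induction k arbitrary: f)
  case 0
  hence *: "M = {#}" if "sf_coeff f M \<noteq> 0" for M using that by force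
  have f: "f = sf_scale (sf_coeff f {#}) (psym_part {#})"
    by (rule symfun_eqI) (use * in \<open>auto simp: sf_coeff_one\<close>)
  show ?case
  proof (cases "sf_coeff f {#} = 0")
    case True
    with f show ?thesis by (metis sf.scale_zero_left sf.span_zero)
  next
    case False
    hence "psym_part {#} \<in> psym_part ` (\<Union>n\<in>I. partitions n)"
      using "0.prems"(1) by (force simp: partitions_def simp del: psym_part_empty)
    with f show ?thesis by (metis sf.span_base sf.span_scale)
  qed
next
  case (Suc k)
  define P where "P = {\<mu> \<in> (\<Union>n\<in>I. partitions n). size \<mu> = Suc k}"
  have P: "finite P" using assms(1) finite_partitions by (simp add: P_def)
  define N where "N \<mu> = (SOME M. exponents M = \<mu>)" for \<mu>
  have N: "exponents (N \<mu>) = \<mu>" if "0 \<notin># \<mu>" for \<mu>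
    unfolding N_def using exists_exponents[OF that] by (rule someI_ex)
  \<comment> \<open>On monomials in exactly \<open>Suc k\<close> variables with exponents \<nu>,
    only the product for \<nu> is nonzero among those in P. It is therefore enough to match f at one
    representative \<open>N \<nu>\<close> of each orbit.\<close>
  define c where "c \<mu> = sf_coeff f (N \<mu>) / sf_coeff (psym_part \<mu>) (N \<mu>)" for \<mu>
  define g where "g = f - (\<Sum>\<mu>\<in>P. sf_scale (c \<mu>) (psym_part \<mu>))"
  have g: "sf_coeff g M = sf_coeff f M - (\<Sum>\<mu>\<in>P. c \<mu> * sf_coeff (psym_part \<mu>) M)" for M
    by (simp add: g_def sf_coeff_sum)
  have "g \<in> sf.span (psym_part ` (\<Union>n\<in>I. partitions n))"
  proof (rule Suc.IH)
    fix M assume "sf_coeff g M \<noteq> 0"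
    hence cases: "sf_coeff f M \<noteq> 0 \<or> (\<exists>\<mu>\<in>P. sf_coeff (psym_part \<mu>) M \<noteq> 0)"
      unfolding g by (metis (no_types, lifting) diff_self mult_zero_right sum.neutral)
    thus I: "size M \<in> I"
      using Suc.prems(1) sf_coeff_psym_part_nonzeroD(1) by (fastforce simp: P_def partitions_def)
    have "card (set_mset M) \<le> Suc k"
      using cases Suc.prems(2) sf_coeff_psym_part_nonzeroD(2) by (fastforce simp: P_def partitions_def)
    moreover have "card (set_mset M) \<noteq> Suc k"
    proof
      assume card: "card (set_mset M) = Suc k"
      define \<nu> where "\<nu> = exponents M"
      have \<nu>: "0 \<notin># \<nu>" "\<nu> \<in> P"
        using zero_notin_exponents sum_mset_exponents I card size_exponents
        by (auto simp: \<nu>_def P_def partitions_def)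
      have "(\<Sum>\<mu>\<in>P. c \<mu> * sf_coeff (psym_part \<mu>) M) = (\<Sum>\<mu>\<in>{\<nu>}. c \<mu> * sf_coeff (psym_part \<mu>) M)"
        using sf_coeff_psym_part_nonzeroD(3)[of _ M] \<nu>(2) card P
        by (intro sum.mono_neutral_right) (auto simp: P_def partitions_def \<nu>_def)
      also have "\<dots> = sf_coeff f M"
      proof -
        have eq: "exponents M = exponents (N \<nu>)" using N[OF \<nu>(1)] by (simp add: \<nu>_def)
        show ?thesis
          using sf_coeff_psym_part_exponents[OF \<nu>(1) N[OF \<nu>(1)]]
          by (simp add: c_def sf_coeff_eq_if_exponents_eq[OF eq])
      qed
      finally show False using \<open>sf_coeff g M \<noteq> 0\<close> by (simp add: g)
    qed
    ultimately show "card (set_mset M) \<le> k" by simp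
  qed
  moreover have "(\<Sum>\<mu>\<in>P. sf_scale (c \<mu>) (psym_part \<mu>)) \<in> sf.span (psym_part ` (\<Union>n\<in>I. partitions n))"
    by (intro sf.span_sum sf.span_scale sf.span_base) (auto simp: P_def)
  ultimately have "g + (\<Sum>\<mu>\<in>P. sf_scale (c \<mu>) (psym_part \<mu>)) \<in>
      sf.span (psym_part ` (\<Union>n\<in>I. partitions n))"
    by (rule sf.span_add)
  thus ?case by (simp add: g_def)
qed

lemma card_set_mset_le_size: "card (set_mset M) \<le> size M"
proof (induction M)
  case (add x M)
  thus ?case by (cases "x \<in># M") (auto simp: insert_absorb)
qed simp

lemma span_psym_part: "sf.span (psym_part ` parts) = UNIV"
proof (intro subset_antisym subset_UNIV subsetI)
  fix f
  obtain d where d: "\<And>M. sf_coeff f M \<noteq> 0 \<Longrightarrow> size M \<le> d" using sf_coeff[of f] by blast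
  have "f \<in> sf.span (psym_part ` (\<Union>n\<in>{..d}. partitions n))"
    by (rule in_span_psym_part[of _ _ d]) (use d card_set_mset_le_size order_trans in fastforce)+
  moreover have "(\<Union>n\<in>{..d}. partitions n) \<subseteq> parts" by (auto simp: partitions_def parts_def)
  ultimately show "f \<in> sf.span (psym_part ` parts)"
    by (meson image_mono sf.span_mono subsetD)
qed

lemma subspace_sf_homogeneous: "sf.subspace (sf_homogeneous n)"
proof (rule sf.subspaceI)
  show "f + g \<in> sf_homogeneous n" if "f \<in> sf_homogeneous n" "g \<in> sf_homogeneous n" for f g
    using that unfolding sf_homogeneous_def by (auto, metis add.right_neutral)
qed (auto simp: sf_homogeneous_def)

text \<open>The set of admissible degrees in \<open>in_span_psym_part\<close> is taken to be {n};
  conversely p_\<mu> involves only monomials of degree \<open>sum_mset \<mu>\<close>.\<close>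

lemma sf_homogeneous_eq_span: "sf_homogeneous n = sf.span (psym_part ` partitions n)"
proof
  show "sf_homogeneous n \<subseteq> sf.span (psym_part ` partitions n)"
  proof
    fix f assume "f \<in> sf_homogeneous n"
    thus "f \<in> sf.span (psym_part ` partitions n)"
      using in_span_psym_part[of "{n}" f n] card_set_mset_le_size
      by (auto simp: sf_homogeneous_def)
  qed
  show "sf.span (psym_part ` partitions n) \<subseteq> sf_homogeneous n"
    by (rule sf.span_minimal[OF _ subspace_sf_homogeneous])
       (auto simp: sf_homogeneous_def partitions_def dest: sf_coeff_psym_part_nonzeroD(1))
qed

section \<open>Operators on polynomials\<close>

lemma app_simps [simp]:
  "app 0 f = 0" "app 1 f = f" "app (S + T) f = app S f + app T f"
  "app (S - T) f = app S f - app T f" "app (S * T) f = app S (app T f)"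
  "app (end_scale c T) f = qxy_scale c (app T f)" "app (mult_op g) f = g * f"
  by (simp_all add: zero_qxy_end.rep_eq one_qxy_end.rep_eq plus_qxy_end.rep_eq minus_qxy_end.rep_eq
      times_qxy_end.rep_eq end_scale.rep_eq app_mult_op)

lemma app_sum: "app (sum T A) f = (\<Sum>i\<in>A. app (T i) f)"
  by (induction A rule: infinite_finite_induct) simp_all

lemma app_of_nat: "app (of_nat n) f = of_nat n * f"
  by (induction n) (simp_all add: distrib_right)

lemma app_add: "app T (f + g) = app T f + app T g"
  and app_scale: "app T (qxy_scale c f) = qxy_scale c (app T f)"
  using app[of T] by (auto simp: qxy_linear_iff)

lemma qxy_end_eqI: "(\<And>f. app S f = app T f) \<Longrightarrow> S = T"
  by (metis app_inject ext)

lemma end_scale_mult_left: "end_scale c S * T = end_scale c (S * T)"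
  and end_scale_mult_right: "S * end_scale c T = end_scale c (S * T)"
  by (auto intro!: qxy_end_eqI simp: app_scale)

lemma mult_op_mult: "mult_op (f * g) = mult_op f * mult_op g"
  by (rule qxy_end_eqI) (simp add: mult.assoc)

lemma mult_op_1 [simp]: "mult_op 1 = 1"
  by (rule qxy_end_eqI) simp

lemma mult_op_power: "mult_op (f ^ n) = mult_op f ^ n"
  by (induction n) (simp_all add: mult_op_mult)

lemma mult_op_commute: "mult_op f * mult_op g = mult_op g * mult_op f"
  by (simp add: mult.commute flip: mult_op_mult)

lemma qxy_const_simps:
  "qxy_const (a + b) = qxy_const a + qxy_const b" "qxy_const (a * b) = qxy_const a * qxy_const b"
  "qxy_const 0 = 0" "qxy_const 1 = 1"
  by (simp_all add: qxy_const_def one_pCons)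

lemma qxy_const_of_nat: "qxy_const (of_nat n) = of_nat n"
  by (induction n) (simp_all add: qxy_const_simps)

text \<open>As \<open>y = \<delta> + x\<close>, the elements \<open>x\<close> and \<open>\<delta>\<close> generate \<open>\<rat>[x,y]\<close>.\<close>

lemma qxy_induct [case_names const add x \<delta>]:
  assumes "\<And>c. P (qxy_const c)" "\<And>f g. P f \<Longrightarrow> P g \<Longrightarrow> P (f + g)"
    and "\<And>f. P f \<Longrightarrow> P (xvar * f)" "\<And>f. P f \<Longrightarrow> P (\<delta> * f)"
  shows "P f"
proof (induction f)
  case 0
  show ?case using assms(1)[of 0] by (simp add: qxy_const_simps)
next
  case (pCons a f)
  have "P [:a:]"
  proof (induction a)
    case 0
    show ?case using assms(1)[of 0] by (simp add: qxy_const_simps)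
  next
    case (pCons c a)
    have "[:pCons c a:] = qxy_const c + xvar * [:a:]"
      by (simp add: qxy_const_def xvar_def)
    thus ?case using assms(1-3) pCons.IH by (simp only:)
  qed
  moreover have "pCons a f = [:a:] + (\<delta> * f + xvar * f)"
    by (simp add: \<delta>_def yvar_def algebra_simps)
  ultimately show ?case using assms pCons by simp
qed

lemma app_D_op: "app D_op f = map_poly pderiv f + pderiv f"
  by (simp add: D_op.rep_eq)

lemma pderiv_sum: "pderiv (sum f A) = (\<Sum>i\<in>A. pderiv (f i))"
  by (induction A rule: infinite_finite_induct) (simp_all add: pderiv_add)

lemma D_op_mult: "app D_op (f * g) = f * app D_op g + app D_op f * g"
proof -
  have "map_poly pderiv (f * g) = f * map_poly pderiv g + map_poly pderiv f * g"
    by (rule poly_eqI)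
       (simp add: coeff_map_poly coeff_mult pderiv_sum pderiv_mult sum.distrib
         mult.commute[of "pderiv (coeff f i)" "coeff g j" for i j])
  thus ?thesis by (simp add: app_D_op pderiv_mult algebra_simps)
qed

lemma D_op_const [simp]: "app D_op (qxy_const c) = 0"
  and D_op_x [simp]: "app D_op xvar = 1"
  and D_op_y [simp]: "app D_op yvar = 1"
  and D_op_\<delta> [simp]: "app D_op \<delta> = 0"
proof -
  show *: "app D_op (qxy_const c) = 0" "app D_op xvar = 1" "app D_op yvar = 1"
    by (simp_all add: app_D_op qxy_const_def xvar_def yvar_def pderiv_pCons map_poly_pCons one_pCons)
  show "app D_op \<delta> = 0"
    using * app_add[of D_op "yvar - xvar" xvar] by (simp add: \<delta>_def)
qed

lemma D_op_power: "app D_op (f ^ n) = of_nat n * f ^ (n - 1) * app D_op f"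
proof (induction n)
  case 0
  show ?case using D_op_const[of 1] by (simp add: qxy_const_simps)
next
  case (Suc n)
  thus ?case by (cases n) (simp_all add: D_op_mult algebra_simps)
qed

lemma D_op_of_nat_mult: "app D_op (of_nat n * f) = of_nat n * app D_op f"
  using app_scale[of D_op "of_nat n" f] by (simp add: qxy_scale_def qxy_const_of_nat)

section \<open>The operators G_r and their Newton identity\<close>

lemma mult_op_\<delta>_D_op: "mult_op \<delta> * D_op = D_op * mult_op \<delta>"
  by (rule qxy_end_eqI) (simp add: D_op_mult)

text \<open>D annihilates \<delta>, so multiplication by \<delta> commutes with D, and hence with
  everything composed of D and multiplications.\<close>

lemma mult_op_\<delta>_G_op: "mult_op \<delta> * G_op r = G_op r * mult_op \<delta>"
proof (cases "r = 0")
  case False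
  have "mult_op \<delta> * (mult_op (xvar ^ j) * D_op ^ j) = mult_op (xvar ^ j) * D_op ^ j * mult_op \<delta>" for j
    by (metis mult.assoc mult_op_commute power_commuting_commutes[OF mult_op_\<delta>_D_op[symmetric]])
  hence *: "mult_op \<delta> * (\<Sum>j = 1..r. end_scale (c j) (mult_op (xvar ^ j) * D_op ^ j)) =
      (\<Sum>j = 1..r. end_scale (c j) (mult_op (xvar ^ j) * D_op ^ j)) * mult_op \<delta>" for c
    by (simp add: sum_distrib_left sum_distrib_right end_scale_mult_left end_scale_mult_right)
  have "mult_op \<delta> * (mult_op (yvar ^ r) * S) = mult_op (yvar ^ r) * (mult_op \<delta> * S)" for S
    by (metis mult.assoc mult_op_commute)
  thus ?thesis using False * by (simp add: G_op_def mult.assoc)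
qed (simp add: G_op_def)

text \<open>The factor x^j is restored to avoid the truncated exponent b - j: for j > b both sides
  vanish.\<close>

lemma D_op_pow_x_pow: "app (D_op ^ j) (xvar ^ b) * xvar ^ j = of_nat (fact j * (b choose j)) * xvar ^ b"
proof -
  have D: "app (D_op ^ j) (xvar ^ b) = of_nat (fact j * (b choose j)) * xvar ^ (b - j)"
  proof (induction j)
    case (Suc j)
    have fact: "fact j * (b choose j) * (b - j) = fact (Suc j) * (b choose Suc j)"
    proof -
      have "(b choose j) * (b - j) = Suc j * (b choose Suc j)"
        by (simp only: binomial_absorption binomial_absorb_comp mult.commute[of "b choose j"])
      thus ?thesis by (simp only: fact_Suc of_nat_id mult_ac)
    qed
    have "app (D_op ^ Suc j) (xvar ^ b) =
        of_nat (fact j * (b choose j)) * (of_nat (b - j) * xvar ^ (b - j - 1))"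
      by (simp only: power_Suc app_simps Suc.IH D_op_of_nat_mult D_op_power D_op_x mult_1_right)
    also have "\<dots> = of_nat (fact j * (b choose j) * (b - j)) * xvar ^ (b - Suc j)"
      by (simp add: mult.assoc)
    finally show ?case by (simp only: fact)
  qed simp
  show ?thesis
    by (cases "j \<le> b") (simp_all add: D mult.assoc binomial_eq_0 flip: power_add)
qed

lemma G_op_x_pow:
  "app (G_op r) (xvar ^ b) = of_nat ((b + r - 1) choose r) * (yvar ^ r * xvar ^ b)"
proof (cases "r = 0")
  case False
  have "app (G_op r) (xvar ^ b) = yvar ^ r * (\<Sum>j = 1..r.
      qxy_const (of_nat ((r - 1) choose (j - 1)) / fact j) * (app (D_op ^ j) (xvar ^ b) * xvar ^ j))"
    using False by (simp add: G_op_def app_sum qxy_scale_def mult.commute mult.left_commute)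
  also have "\<dots> = yvar ^ r * (\<Sum>j = 1..r. of_nat (((r - 1) choose (j - 1)) * (b choose j)) * xvar ^ b)"
  proof (rule arg_cong[where f = "(*) (yvar ^ r)"], rule sum.cong[OF refl])
    fix j
    have "qxy_const (of_nat ((r - 1) choose (j - 1)) / fact j) * (of_nat (fact j * (b choose j)) * xvar ^ b)
      = qxy_const (of_nat ((r - 1) choose (j - 1)) / fact j * of_nat (fact j * (b choose j))) * xvar ^ b"
      by (simp only: qxy_const_simps qxy_const_of_nat mult.assoc)
    also have "of_nat ((r - 1) choose (j - 1)) / fact j * of_nat (fact j * (b choose j)) =
        (of_nat (((r - 1) choose (j - 1)) * (b choose j)) :: rat)" by simp
    finally show "qxy_const (of_nat ((r - 1) choose (j - 1)) / fact j) *
        (app (D_op ^ j) (xvar ^ b) * xvar ^ j) = of_nat (((r - 1) choose (j - 1)) * (b choose j)) * xvar ^ b"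
      by (simp only: qxy_const_of_nat D_op_pow_x_pow)
  qed
  also have "\<dots> = of_nat (\<Sum>j = 1..r. ((r - 1) choose (j - 1)) * (b choose j)) * (yvar ^ r * xvar ^ b)"
    by (simp add: sum_distrib_left sum_distrib_right mult_ac)
  \<comment> \<open>Reflecting the first binomial coefficient gives the shape of Vandermonde's
    convolution. The added term j = 0 contains \<open>(r - 1) choose r\<close>, which is 0.\<close>
  also have "(\<Sum>j = 1..r. ((r - 1) choose (j - 1)) * (b choose j)) =
      (\<Sum>j\<le>r. (b choose j) * ((r - 1) choose (r - j)))"
  proof (rule sum.mono_neutral_cong_left)
    fix j assume "j \<in> {1..r}"
    thus "((r - 1) choose (j - 1)) * (b choose j) = (b choose j) * ((r - 1) choose (r - j))"
      using binomial_symmetric[of "j - 1" "r - 1"] by (simp add: mult.commute diff_le_mono)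
  qed (use False in \<open>auto simp: binomial_eq_0 not_le\<close>)
  also have "\<dots> = (b + r - 1) choose r"
    using False by (simp only: vandermonde) (simp add: Suc_le_eq)
  finally show ?thesis .
qed (simp add: G_op_def)

lemma G_op_1: "app (G_op 1) f = xvar * yvar * app D_op f"
  by (simp add: G_op_def qxy_scale_def qxy_const_simps algebra_simps)

text \<open>An operator commuting with \<delta> is linear over Q[\<delta>], and the powers of x span
  Q[x,y] over that ring.\<close>

lemma qxy_end_eq_if_eq_on_x_pow:
  assumes "mult_op \<delta> * S = S * mult_op \<delta>" "mult_op \<delta> * T = T * mult_op \<delta>"
    and "\<And>b. app S (xvar ^ b) = app T (xvar ^ b)"
  shows "S = T"
proof (rule qxy_end_eqI)
  fix f
  have \<delta>: "app S (\<delta> * g) = \<delta> * app S g" "app T (\<delta> * g) = \<delta> * app T g" for g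
    using assms(1,2) by (metis app_simps(5,7))+
  \<comment> \<open>The operators are not linear over x. The extra factor x^b absorbs the x of the
    induction step by raising b.\<close>
  have "app S (f * xvar ^ b) = app T (f * xvar ^ b)" for b
  proof (induction f arbitrary: b rule: qxy_induct)
    case (const c)
    show ?case using assms(3) by (simp add: app_scale flip: qxy_scale_def)
  next
    case (x f)
    show ?case using x[of "Suc b"] by (simp add: mult_ac)
  qed (simp_all add: distrib_right app_add mult.assoc \<delta>)
  from this[of 0] show "app S f = app T f" by simp
qed

text \<open>Evaluated on \<open>x\<^sup>b\<close>, the right-hand side telescopes.\<close>

lemma newton_G_op:
  "of_nat n * G_op n = (\<Sum>i = 1..n. mult_op \<delta> ^ (i - 1) * G_op 1 * G_op (n - i))"
proof (rule qxy_end_eq_if_eq_on_x_pow)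
  have "mult_op \<delta> * (mult_op \<delta> ^ (i - 1) * G_op 1 * G_op (n - i)) =
      mult_op \<delta> ^ (i - 1) * G_op 1 * G_op (n - i) * mult_op \<delta>" for i
    by (metis mult.assoc mult_op_\<delta>_G_op power_commutes)
  thus "mult_op \<delta> * (\<Sum>i = 1..n. mult_op \<delta> ^ (i - 1) * G_op 1 * G_op (n - i)) =
      (\<Sum>i = 1..n. mult_op \<delta> ^ (i - 1) * G_op 1 * G_op (n - i)) * mult_op \<delta>"
    by (simp only: sum_distrib_left sum_distrib_right)
  show "mult_op \<delta> * (of_nat n * G_op n) = of_nat n * G_op n * mult_op \<delta>"
    by (metis mult.assoc mult_of_nat_commute mult_op_\<delta>_G_op)
next
  fix b
  define c :: "nat \<Rightarrow> qxy" where "c r = of_nat ((b + r - 1) choose r)" for r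
  \<comment> \<open>Absorption yields the recursion (r + 1) c_(r+1) = (b + r) c_r, which makes
    neighbouring terms of the sum comparable.\<close>
  have "(b + r) * ((b + r - 1) choose r) = Suc r * ((b + Suc r - 1) choose Suc r)" for r
    using Suc_times_binomial[of r "b + r - 1"] by (cases "b + r") auto
  hence c: "of_nat (Suc r) * c (Suc r) = of_nat (b + r) * c r" for r
    unfolding c_def of_nat_mult[symmetric] by (simp only:)
  have G1: "app (G_op 1) (yvar ^ r * xvar ^ b) = (of_nat r * xvar + of_nat b * yvar) * yvar ^ r * xvar ^ b" for r
  proof -
    have pow: "of_nat k * z ^ (k - 1) * z = of_nat k * z ^ k" for k and z :: qxy
      by (cases k) simp_all
    have "app (G_op 1) (yvar ^ r * xvar ^ b) =
        (of_nat b * xvar ^ (b - 1) * xvar) * yvar * yvar ^ r + (of_nat r * yvar ^ (r - 1) * yvar) * xvar * xvar ^ b"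
      by (simp only: G_op_1 D_op_mult D_op_power D_op_x D_op_y mult_1_right) (simp only: algebra_simps)
    thus ?thesis unfolding pow by (simp add: algebra_simps)
  qed
  have x: "xvar = yvar - \<delta>" by (simp add: \<delta>_def)
  have "app (\<Sum>i = 1..n. mult_op \<delta> ^ (i - 1) * G_op 1 * G_op (n - i)) (xvar ^ b) =
      (\<Sum>i = 1..n. \<delta> ^ (i - 1) * (c (n - i) * app (G_op 1) (yvar ^ (n - i) * xvar ^ b)))"
    using app_scale[of "G_op 1" "of_nat k" for k]
    by (simp add: app_sum G_op_x_pow c_def qxy_scale_def qxy_const_of_nat flip: mult_op_power)
  also have "\<dots> = (\<Sum>r<n. \<delta> ^ (n - Suc r) * (c r * app (G_op 1) (yvar ^ r * xvar ^ b)))"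
    by (rule sum.reindex_bij_witness[where i = "\<lambda>r. n - r" and j = "\<lambda>i. n - i"]) auto
  \<comment> \<open>Each summand becomes F(r+1) - F(r) with F(r) = r c_r \<delta>^(n-r) y^r x^b.
    Here F(0) = 0, and F(n) is the value of n G_n on x^b.\<close>
  also have "\<dots> = (\<Sum>r<n. \<delta> ^ (n - Suc r) * of_nat (Suc r) * c (Suc r) * yvar ^ Suc r * xvar ^ b -
      \<delta> ^ (n - r) * of_nat r * c r * yvar ^ r * xvar ^ b)"
  proof (rule sum.cong[OF refl])
    fix r assume r: "r \<in> {..<n}"
    hence \<delta>: "\<delta> ^ (n - r) = \<delta> * \<delta> ^ (n - Suc r)"
      by (simp add: Suc_diff_Suc flip: power_Suc)
    have "\<delta> ^ (n - Suc r) * of_nat (Suc r) * c (Suc r) * yvar ^ Suc r * xvar ^ b =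
        \<delta> ^ (n - Suc r) * (of_nat (Suc r) * c (Suc r)) * yvar ^ Suc r * xvar ^ b" by (simp only: mult.assoc)
    also have "\<dots> = \<delta> ^ (n - Suc r) * c r * (of_nat (b + r) * yvar) * yvar ^ r * xvar ^ b"
      unfolding c by (simp add: mult_ac)
    finally have eq: "\<delta> ^ (n - Suc r) * of_nat (Suc r) * c (Suc r) * yvar ^ Suc r * xvar ^ b = \<dots>" .
    have lin: "of_nat r * xvar + of_nat b * yvar = of_nat (b + r) * yvar - of_nat r * \<delta>"
      by (simp add: x algebra_simps)
    show "\<delta> ^ (n - Suc r) * (c r * app (G_op 1) (yvar ^ r * xvar ^ b)) =
        \<delta> ^ (n - Suc r) * of_nat (Suc r) * c (Suc r) * yvar ^ Suc r * xvar ^ b -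
        \<delta> ^ (n - r) * of_nat r * c r * yvar ^ r * xvar ^ b"
      unfolding G1 \<delta> eq lin by (simp add: algebra_simps)
  qed
  also have "\<dots> = of_nat n * c n * yvar ^ n * xvar ^ b"
    by (subst sum_lessThan_telescope) simp
  finally show "app (of_nat n * G_op n) (xvar ^ b) =
      app (\<Sum>i = 1..n. mult_op \<delta> ^ (i - 1) * G_op 1 * G_op (n - i)) (xvar ^ b)"
    by (simp only: app_simps app_of_nat G_op_x_pow c_def mult.assoc)
qed

section \<open>The operators \<delta>^n E^l in polynomial form and their linear independence\<close>

definition \<delta>G :: "nat \<Rightarrow> nat \<Rightarrow> qxy_end" where
  "\<delta>G n l = mult_op \<delta> ^ (n - l) * G_op 1 ^ l"

lemma \<delta>G_0_0: "\<delta>G 0 0 = 1"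
  by (simp add: \<delta>G_def)

lemma \<delta>G_1: "\<delta>G m 1 = mult_op \<delta> ^ (m - 1) * G_op 1"
  by (simp add: \<delta>G_def)

lemma \<delta>G_mult:
  assumes "l \<le> n" "k \<le> m"
  shows "\<delta>G n l * \<delta>G m k = \<delta>G (n + m) (l + k)"
proof -
  have *: "G_op 1 ^ l * mult_op \<delta> ^ (m - k) = mult_op \<delta> ^ (m - k) * G_op 1 ^ l"
    by (metis mult_op_\<delta>_G_op power_commuting_commutes)
  have "\<delta>G n l * \<delta>G m k = mult_op \<delta> ^ (n - l) * (G_op 1 ^ l * mult_op \<delta> ^ (m - k)) * G_op 1 ^ k"
    by (simp add: \<delta>G_def mult.assoc)
  also have "\<dots> = mult_op \<delta> ^ (n - l + (m - k)) * G_op 1 ^ (l + k)"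
    by (simp only: * mult.assoc power_add)
  also have "n - l + (m - k) = n + m - (l + k)" using assms by simp
  finally show ?thesis by (simp add: \<delta>G_def)
qed

text \<open>Modulo x^(b+1), each application of xyD multiplies the leading term by b y, since
  differentiating the cofactor of x^b only produces higher powers of x. Moreover \<delta> is
  congruent to y modulo x.\<close>

lemma \<delta>G_x_pow:
  assumes "l \<le> n"
  shows "\<exists>r. app (\<delta>G n l) (xvar ^ b) = xvar ^ b * (of_nat (b ^ l) * yvar ^ n + xvar * r)"
proof -
  have "\<exists>r. app (G_op 1 ^ l) (xvar ^ b) = xvar ^ b * (of_nat (b ^ l) * yvar ^ l + xvar * r)"
  proof (induction l)
    case 0
    show ?case by (intro exI[of _ 0]) simp
  next
    case (Suc l)
    then obtain r where r: "app (G_op 1 ^ l) (xvar ^ b) = xvar ^ b * (of_nat (b ^ l) * yvar ^ l + xvar * r)"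
      by blast
    have b: "of_nat b * xvar ^ (b - 1) * xvar = of_nat b * xvar ^ b" by (cases b) simp_all
    define D1 where "D1 = app D_op (of_nat (b ^ l) * yvar ^ l + xvar * r)"
    define q where "q = of_nat (b ^ l) * yvar ^ l + xvar * r"
    have "app (G_op 1 ^ Suc l) (xvar ^ b) = xvar * yvar * (xvar ^ b * D1 + of_nat b * xvar ^ (b - 1) * q)"
      by (simp only: power_Suc app_simps r G_op_1 D_op_mult D_op_power D_op_x mult_1_right D1_def q_def)
    also have "\<dots> = xvar ^ b * (xvar * yvar * D1) + yvar * (of_nat b * xvar ^ (b - 1) * xvar) * q"
      by (simp add: algebra_simps)
    also have "\<dots> = xvar ^ b * (of_nat (b ^ Suc l) * yvar ^ Suc l + xvar * (yvar * D1 + of_nat b * yvar * r))"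
      unfolding b q_def by (simp add: algebra_simps)
    finally show ?case by blast
  qed
  then obtain r where r: "app (G_op 1 ^ l) (xvar ^ b) = xvar ^ b * (of_nat (b ^ l) * yvar ^ l + xvar * r)"
    by blast
  have "\<exists>s. \<delta> ^ k = yvar ^ k + xvar * s" for k
  proof (induction k)
    case (Suc k)
    then obtain s where "\<delta> ^ k = yvar ^ k + xvar * s" by blast
    hence "\<delta> ^ Suc k = yvar ^ Suc k + xvar * (\<delta> * s - yvar ^ k)"
      by (simp add: \<delta>_def algebra_simps)
    thus ?case by blast
  qed (auto intro: exI[of _ 0])
  then obtain s where s: "\<delta> ^ (n - l) = yvar ^ (n - l) + xvar * s" by blast
  have n: "yvar ^ n = yvar ^ (n - l) * yvar ^ l" using assms by (simp flip: power_add)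
  have "app (\<delta>G n l) (xvar ^ b) =
      xvar ^ b * (of_nat (b ^ l) * yvar ^ n + xvar * (\<delta> ^ (n - l) * r + s * of_nat (b ^ l) * yvar ^ l))"
    by (simp add: \<delta>G_def r s n algebra_simps flip: mult_op_power del: One_nat_def)
  thus ?thesis by blast
qed

text \<open>The coefficient of x^b y^m in the image of x^b isolates the terms with n = m. It is a
  polynomial in b with coefficients \<open>c m l\<close>, and it vanishes at every natural
  number.\<close>

lemma \<delta>G_independent:
  assumes "finite S" "\<And>n l. (n, l) \<in> S \<Longrightarrow> l \<le> n"
    and "(\<Sum>(n, l)\<in>S. end_scale (c n l) (\<delta>G n l)) = 0" "(m, k) \<in> S"
  shows "c m k = 0"
proof -
  define L where "L = {l. (m, l) \<in> S}"
  have L: "finite L"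
    by (rule finite_subset[OF _ finite_imageI[OF assms(1), of snd]]) (force simp: L_def)
  define p where "p = (\<Sum>l\<in>L. monom (c m l) l)"
  have p: "poly p (of_nat b) = 0" for b
  proof -
    have "\<forall>n l. \<exists>r. l \<le> n \<longrightarrow>
        app (\<delta>G n l) (xvar ^ b) = xvar ^ b * (of_nat (b ^ l) * yvar ^ n + xvar * r)"
      using \<delta>G_x_pow by blast
    then obtain r where r: "\<And>n l. l \<le> n \<Longrightarrow>
        app (\<delta>G n l) (xvar ^ b) = xvar ^ b * (of_nat (b ^ l) * yvar ^ n + xvar * r n l)"
      by metis
    have "0 = app (\<Sum>(n, l)\<in>S. end_scale (c n l) (\<delta>G n l)) (xvar ^ b)"
      using assms(3) by simp
    also have "\<dots> = (\<Sum>(n, l)\<in>S. qxy_scale (c n l) (xvar ^ b * (of_nat (b ^ l) * yvar ^ n + xvar * r n l)))"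
      using assms(2) by (auto simp: app_sum r intro!: sum.cong)
    also have "\<dots> = xvar ^ b * (\<Sum>(n, l)\<in>S. qxy_scale (c n l) (of_nat (b ^ l) * yvar ^ n + xvar * r n l))"
      by (auto simp: qxy_scale_def sum_distrib_left algebra_simps intro!: sum.cong)
    finally have "(\<Sum>(n, l)\<in>S. qxy_scale (c n l) (of_nat (b ^ l) * yvar ^ n + xvar * r n l)) = 0"
      by (simp add: xvar_def)
    \<comment> \<open>In Q[x][y] the outer index m extracts y^m, and the inner index 0 sets x =
      0.\<close>
    hence "0 = coeff (coeff (\<Sum>(n, l)\<in>S. qxy_scale (c n l) (of_nat (b ^ l) * yvar ^ n + xvar * r n l)) m) 0"
      by simp
    moreover have "coeff (coeff (qxy_scale c (of_nat (b ^ l) * yvar ^ n + xvar * r n l)) m) 0 =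
        (if n = m then c * of_nat b ^ l else 0)" for c n l
    proof -
      have "of_nat (b ^ l) * yvar ^ n = smult (of_nat (b ^ l)) (monom 1 n)"
        by (simp add: yvar_def monom_altdef of_nat_poly)
      moreover have "coeff (of_nat (b ^ l) :: rat poly) 0 = of_nat b ^ l"
        by (simp add: of_nat_poly)
      ultimately show ?thesis
        by (simp add: qxy_scale_def qxy_const_def xvar_def)
    qed
    ultimately have "0 = (\<Sum>(n, l)\<in>S. if n = m then c n l * of_nat b ^ l else 0)"
      by (simp add: coeff_sum case_prod_unfold)
    also have "\<dots> = (\<Sum>(n, l)\<in>Pair m ` L. c n l * of_nat b ^ l)"
      by (rule sum.mono_neutral_cong_right) (use assms(1) in \<open>auto simp: L_def\<close>)
    also have "\<dots> = poly p (of_nat b)"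
      by (subst sum.reindex) (simp_all add: p_def poly_sum poly_monom inj_on_def)
    finally show ?thesis by simp
  qed
  have "infinite {x. poly p x = 0}"
    by (rule infinite_super[of "range of_nat"]) (use p in \<open>auto simp: range_inj_infinite inj_def\<close>)
  hence "p = 0" using poly_roots_finite by blast
  moreover have "coeff p k = c m k"
    using L assms(4) by (simp add: p_def coeff_sum L_def)
  ultimately show ?thesis by simp
qed

section \<open>The derivation E of the field of rational functions\<close>

lemma xvar_nonzero: "xvar \<noteq> 0" and yvar_nonzero: "yvar \<noteq> 0" and \<delta>_nonzero: "\<delta> \<noteq> 0"
  by (simp_all add: xvar_def yvar_def \<delta>_def)

text \<open>The fraction \<open>w\<close> is the common value E(x) = E(y), so that E = w D on
  polynomials.\<close>

context
  fixes w :: "qxy fract"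
  defines "w \<equiv> to_fract (xvar * yvar) / to_fract \<delta>"
begin

lemma Q_derivation_polynomial:
  assumes d: "Q_derivation d" "d (to_fract \<delta>) = 0" "d u_frac = u_frac"
  shows "d (to_fract f) = w * to_fract (app D_op f)"
proof (induction f rule: qxy_induct)
  have d_add: "d (a + b) = d a + d b"
    and d_scale: "d (to_fract (qxy_const c) * a) = to_fract (qxy_const c) * d a"
    and d_mult: "d (a * b) = a * d b + d a * b" for a b c
    using d(1) by (auto simp: Q_derivation_def)
  {
    case (const c)
    have "d 1 = 0" using d_mult[of 1 1] by simp
    thus ?case using d_scale[of c 1] by simp
  next
    case (add f g)
    thus ?case by (simp add: d_add app_add distrib_left)
  next
    case (x f)
    have y: "to_fract yvar = to_fract xvar + to_fract \<delta>"
      by (simp add: \<delta>_def flip:)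
    have nz: "to_fract xvar \<noteq> 0" "to_fract yvar \<noteq> 0" "to_fract \<delta> \<noteq> 0"
      by (simp_all add: xvar_nonzero yvar_nonzero \<delta>_nonzero)
    \<comment> \<open>From d \<delta> = 0 follows d y = d x. The product rule for x = u y is then a
      linear equation for d x, with solution \<open>w\<close>.\<close>
    have "d (to_fract yvar) = d (to_fract xvar)"
      unfolding y by (simp add: d_add d(2))
    moreover have "d (to_fract xvar) = u_frac * d (to_fract yvar) + u_frac * to_fract yvar"
      using d_mult[of u_frac "to_fract yvar"] d(3) nz by (simp add: u_frac_def)
    ultimately have "d (to_fract xvar) * (1 - u_frac) = u_frac * to_fract yvar"
      by (simp add: algebra_simps)
    hence "d (to_fract xvar) * to_fract \<delta> = to_fract xvar * to_fract yvar"
      using nz y by (simp add: u_frac_def field_simps)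
    hence "d (to_fract xvar) = w"
      using nz by (simp add: w_def field_simps)
    thus ?case using x by (simp add: d_mult D_op_mult algebra_simps)
  next
    case (\<delta> f)
    thus ?case by (simp add: d_mult D_op_mult d(2) algebra_simps)
  }
qed

text \<open>Apply the product rule to q g = f. As every element of the field is such a quotient,
  this also settles the uniqueness of E.\<close>

lemma Q_derivation_quotient:
  assumes d: "Q_derivation d" "d (to_fract \<delta>) = 0" "d u_frac = u_frac" and "g \<noteq> 0"
  shows "d (to_fract f / to_fract g) =
    w * to_fract (app D_op f * g - f * app D_op g) / to_fract g ^ 2"
proof -
  have g: "to_fract g \<noteq> 0" using assms(4) by simp
  define q where "q = to_fract f / to_fract g"
  have "w * to_fract (app D_op f) = d (q * to_fract g)"
    using g by (simp add: q_def Q_derivation_polynomial[OF d])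
  also have "\<dots> = q * d (to_fract g) + d q * to_fract g"
    using d(1) by (simp add: Q_derivation_def)
  finally have "d q * to_fract g = w * to_fract (app D_op f) - q * (w * to_fract (app D_op g))"
    by (simp add: Q_derivation_polynomial[OF d])
  hence "d q * to_fract g ^ 2 = (w * to_fract (app D_op f) - q * (w * to_fract (app D_op g))) * to_fract g"
    by (simp add: power2_eq_square flip: mult.assoc)
  also have "\<dots> = w * (to_fract (app D_op f) * to_fract g - (q * to_fract g) * to_fract (app D_op g))"
    by (simp add: algebra_simps)
  also have "q * to_fract g = to_fract f" using g by (simp add: q_def)
  finally show ?thesis using g by (simp add: q_def eq_divide_eq)
qed

lemma fract_quotientE:
  obtains f g where "q = to_fract f / to_fract (g :: qxy)" "g \<noteq> 0"
  by (metis Fract_cases Fract_conv_to_fract)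

text \<open>The quotient rule serves as the definition; the main point is its independence of the
  chosen fraction.\<close>

lemma exists_Q_derivation: "\<exists>d. Q_derivation d \<and> d (to_fract \<delta>) = 0 \<and> d u_frac = u_frac"
proof -
  define W where "W f g = w * to_fract (app D_op f * g - f * app D_op g) / to_fract g ^ 2" for f g :: qxy
  have W_unique: "W f g = W f' g'"
    if eq: "to_fract f / to_fract g = to_fract f' / to_fract g'" and nz: "g \<noteq> 0" "g' \<noteq> 0" for f g f' g'
  proof -
    have nz': "to_fract g \<noteq> 0" "to_fract g' \<noteq> 0" using nz by auto
    have "to_fract (f * g') = to_fract (f' * g)"
      using eq nz' by (simp add: field_simps)
    hence 1: "f * g' = f' * g" by (simp only: to_fract_eq_iff)
    hence 2: "f * app D_op g' + app D_op f * g' = f' * app D_op g + app D_op f' * g"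
      by (simp flip: D_op_mult)
    \<comment> \<open>The numerator is expressed through f g' and the derivative of f g', which may
      be replaced by f' g and its derivative.\<close>
    have "(app D_op f * g - f * app D_op g) * g' ^ 2 =
        g * g' * (f * app D_op g' + app D_op f * g') - (f * g') * (app D_op g' * g + app D_op g * g')"
      by (simp add: power2_eq_square algebra_simps)
    also have "\<dots> = (app D_op f' * g' - f' * app D_op g') * g ^ 2"
      unfolding 1 2 by (simp add: power2_eq_square algebra_simps)
    finally have eq: "to_fract (app D_op f * g - f * app D_op g) * to_fract g' ^ 2 =
        to_fract (app D_op f' * g' - f' * app D_op g') * to_fract g ^ 2"
      by (simp only: power2_eq_square flip: to_fract_mult)
    thus ?thesis
      using nz' by (simp add: W_def frac_eq_eq mult.assoc eq del: to_fract_diff to_fract_mult)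
  qed
  define d where "d q = (THE r. \<exists>f g. q = to_fract f / to_fract g \<and> g \<noteq> 0 \<and> r = W f g)" for q
  have d: "d (to_fract f / to_fract g) = W f g" if "g \<noteq> 0" for f g
    unfolding d_def
  proof (rule the_equality)
    fix r assume "\<exists>f' g'. to_fract f / to_fract g = to_fract f' / to_fract g' \<and> g' \<noteq> 0 \<and> r = W f' g'"
    thus "r = W f g" using W_unique that by metis
  qed (use that in blast)
  have "Q_derivation d"
    unfolding Q_derivation_def
  proof (intro conjI allI)
    fix a b :: "qxy fract" and c :: rat
    obtain f g where a: "a = to_fract f / to_fract g" "g \<noteq> 0"
      by (rule fract_quotientE[of a])
    obtain f' g' where b: "b = to_fract f' / to_fract g'" "g' \<noteq> 0"
      by (rule fract_quotientE[of b])
    note fg = a(1) b(1) and nz = a(2) b(2)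
    have nz': "to_fract g \<noteq> 0" "to_fract g' \<noteq> 0" "g * g' \<noteq> 0" using nz by auto
    have "a + b = to_fract (f * g' + f' * g) / to_fract (g * g')"
      using nz' fg by (simp add: add_frac_eq)
    hence "d (a + b) = W (f * g' + f' * g) (g * g')" by (simp only: d nz' not_False_eq_True)
    also have "\<dots> = W f g + W f' g'"
      using nz' by (simp add: W_def D_op_mult app_add
          field_simps power2_eq_square)
    finally show "d (a + b) = d a + d b" by (simp only: d nz fg not_False_eq_True)
    have "a * b = to_fract (f * f') / to_fract (g * g')"
      by (simp add: fg)
    hence "d (a * b) = W (f * f') (g * g')" by (simp only: d nz' not_False_eq_True)
    also have "\<dots> = a * W f' g' + W f g * b"
      using nz' by (simp add: fg W_def D_op_mult
          field_simps power2_eq_square)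
    finally show "d (a * b) = a * d b + d a * b" by (simp only: d nz fg not_False_eq_True)
    have "to_fract (qxy_const c) * a = to_fract (qxy_const c * f) / to_fract g"
      by (simp add: fg)
    hence "d (to_fract (qxy_const c) * a) = W (qxy_const c * f) g" by (simp only: d nz not_False_eq_True)
    also have "\<dots> = to_fract (qxy_const c) * W f g"
      by (simp add: W_def D_op_mult algebra_simps)
    finally show "d (to_fract (qxy_const c) * a) = to_fract (qxy_const c) * d a" by (simp only: d nz fg not_False_eq_True)
  qed
  moreover have "app D_op 1 = 0" using D_op_const[of 1] by (simp add: qxy_const_simps)
  hence "d (to_fract \<delta>) = 0" using d[of 1 \<delta>] by (simp add: W_def)
  moreover have "d u_frac = u_frac"
    using d[OF yvar_nonzero, of xvar] yvar_nonzero \<delta>_nonzero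
    by (simp add: u_frac_def W_def w_def power2_eq_square flip: \<delta>_def)
  ultimately show ?thesis by blast
qed

lemma E_op: "Q_derivation E_op" "E_op (to_fract \<delta>) = 0" "E_op u_frac = u_frac"
proof -
  have "\<exists>!d. Q_derivation d \<and> d (to_fract \<delta>) = 0 \<and> d u_frac = u_frac"
  proof (rule ex_ex1I[OF exists_Q_derivation])
    fix d e
    assume "Q_derivation d \<and> d (to_fract \<delta>) = 0 \<and> d u_frac = u_frac"
      "Q_derivation e \<and> e (to_fract \<delta>) = 0 \<and> e u_frac = u_frac"
    thus "d = e"
      by (intro ext) (metis Q_derivation_quotient fract_quotientE)
  qed
  from theI'[OF this] show "Q_derivation E_op" "E_op (to_fract \<delta>) = 0" "E_op u_frac = u_frac"
    by (simp_all add: E_op_def)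
qed

lemma \<delta>_E_op: "to_fract \<delta> * E_op (to_fract f) = to_fract (app (G_op 1) f)"
  using \<delta>_nonzero by (simp add: Q_derivation_polynomial[OF E_op] w_def G_op_1 del: One_nat_def)

end

lemma E_op_\<delta>_pow_mult: "E_op (to_fract \<delta> ^ n * a) = to_fract \<delta> ^ n * E_op a"
proof (induction n)
  case (Suc n)
  thus ?case using E_op(1,2) by (simp add: Q_derivation_def mult.assoc)
qed simp

text \<open>E commutes with multiplication by \<delta>, so \<delta>^l E^l is the l-th power of
  \<delta> E = G_1.\<close>

lemma \<delta>_pow_E_op_pow: "to_fract \<delta> ^ l * (E_op ^^ l) (to_fract f) = to_fract (app (G_op 1 ^ l) f)"
proof (induction l)
  case (Suc l)
  have "to_fract \<delta> ^ Suc l * (E_op ^^ Suc l) (to_fract f) =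
      to_fract \<delta> * E_op (to_fract \<delta> ^ l * (E_op ^^ l) (to_fract f))"
    by (simp add: E_op_\<delta>_pow_mult mult.assoc)
  thus ?case by (simp only: Suc.IH \<delta>_E_op power_Suc app_simps)
qed simp

text \<open>For l <= n one can split \<delta>^n as \<delta>^(n-l) \<delta>^l. The described operator
  is unique because Q[x,y] embeds in its fraction field. The case l = 0 serves the empty
  partition.\<close>

lemma \<delta>E_eq:
  assumes "l \<le> n"
  shows "\<delta>E n l = \<delta>G n l"
  unfolding \<delta>E_def
proof (rule the_equality)
  have \<delta>_pow: "to_fract (\<delta> ^ k) = to_fract \<delta> ^ k" for k
    by (induction k) (simp_all add: to_fract_mult)
  have n: "to_fract \<delta> ^ n = to_fract \<delta> ^ (n - l) * to_fract \<delta> ^ l"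
    using assms by (simp flip: power_add)
  show *: "\<forall>f. to_fract (app (\<delta>G n l) f) = to_fract \<delta> ^ n * (E_op ^^ l) (to_fract f)"
    by (simp add: \<delta>G_def \<delta>_pow n mult.assoc \<delta>_pow_E_op_pow flip: mult_op_power)
  fix T assume T: "\<forall>f. to_fract (app T f) = to_fract \<delta> ^ n * (E_op ^^ l) (to_fract f)"
  show "T = \<delta>G n l"
    by (rule qxy_end_eqI) (metis T * to_fract_eq_iff)
qed

section \<open>The homomorphism and its kernel\<close>

lemma end_scale_of_nat: "end_scale (of_nat n) T = of_nat n * T"
  by (rule qxy_end_eqI) (simp add: app_of_nat qxy_scale_def qxy_const_of_nat)

lemma of_nat_mult_qxy_end_cancel:
  assumes "of_nat n * S = of_nat n * (T :: qxy_end)" "n > 0"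
  shows "S = T"
proof -
  have "end_scale (of_nat n) S = end_scale (of_nat n) T"
    using assms(1) by (simp add: end_scale_of_nat)
  thus ?thesis using assms(2) by simp
qed

lemma size_le_sum_mset: "\<mu> \<in> parts \<Longrightarrow> size \<mu> \<le> sum_mset \<mu>"
  unfolding parts_def by (induction \<mu>) auto

text \<open>The target space is left general because the extension is needed for \<rho>, for the
  projection to hooks and for the map that annihilates hooks.\<close>

lemma psym_part_linear_extension:
  assumes "vector_space s"
  shows "\<exists>\<phi>. Vector_Spaces.linear sf_scale s \<phi> \<and> (\<forall>\<mu>\<in>parts. \<phi> (psym_part \<mu>) = F \<mu>)"
proof -
  interpret vector_space_pair sf_scale s
    by (rule vector_space_pair.intro[OF sf.vector_space_axioms assms])
  obtain \<phi> where "Vector_Spaces.linear sf_scale s \<phi>"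
      "\<forall>x\<in>psym_part ` parts. \<phi> x = (F \<circ> inv_into parts psym_part) x"
    using linear_independent_extend[OF independent_psym_part] by blast
  thus ?thesis using inj_on_psym_part by auto
qed

lemma psym_part_linear_eqI:
  assumes "Vector_Spaces.linear sf_scale s \<phi>" "Vector_Spaces.linear sf_scale s \<psi>"
    and "\<And>\<mu>. \<mu> \<in> parts \<Longrightarrow> \<phi> (psym_part \<mu>) = \<psi> (psym_part \<mu>)"
  shows "\<phi> = \<psi>"
proof
  interpret \<phi>: Vector_Spaces.linear sf_scale s \<phi> by fact
  interpret vector_space_pair sf_scale s by unfold_locales
  fix f
  show "\<phi> f = \<psi> f"
    by (rule linear_eq_on[OF assms(1,2), of f "psym_part ` parts"])
       (use assms(3) in \<open>auto simp: span_psym_part\<close>)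
qed

lemma unital_alg_homD:
  assumes "unital_alg_hom \<phi>"
  shows "\<phi> (f + g) = \<phi> f + \<phi> g" "\<phi> (f - g) = \<phi> f - \<phi> g" "\<phi> 0 = 0"
    "\<phi> (sf_scale c f) = end_scale c (\<phi> f)" "\<phi> (sum F A) = (\<Sum>i\<in>A. \<phi> (F i))"
    "\<phi> 1 = 1" "\<phi> (f * g) = \<phi> f * \<phi> g" "\<phi> (of_nat n * f) = of_nat n * \<phi> f"
proof -
  interpret \<phi>: Vector_Spaces.linear sf_scale end_scale \<phi>
    using assms by (simp add: unital_alg_hom_def)
  show "\<phi> (f + g) = \<phi> f + \<phi> g" "\<phi> (f - g) = \<phi> f - \<phi> g" "\<phi> 0 = 0"
    "\<phi> (sf_scale c f) = end_scale c (\<phi> f)" "\<phi> (sum F A) = (\<Sum>i\<in>A. \<phi> (F i))"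
    by (simp_all add: \<phi>.add \<phi>.diff \<phi>.zero \<phi>.scale \<phi>.sum)
  show "\<phi> (of_nat n * f) = of_nat n * \<phi> f"
    by (metis \<phi>.scale sf_scale_of_nat end_scale_of_nat)
  show "\<phi> 1 = 1" "\<phi> (f * g) = \<phi> f * \<phi> g"
    using assms by (auto simp: unital_alg_hom_def)
qed

lemma newton_\<delta>G: "of_nat n * G_op n = (\<Sum>i = 1..n. \<delta>G i 1 * G_op (n - i))"
  by (simp only: newton_G_op \<delta>G_1)

text \<open>By Newton's identity, prescribing a homomorphism on the \<open>h\<^sub>r\<close> amounts to prescribing it
  on the \<open>p\<^sub>m\<close>.\<close>

lemma hom_psym_if_hom_hsym:
  assumes \<phi>: "unital_alg_hom \<phi>" "\<And>r. r \<ge> 1 \<Longrightarrow> \<phi> (hsym r) = G_op r"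
  shows "m \<ge> 1 \<Longrightarrow> \<phi> (psym m) = \<delta>G m 1"
proof (induction m rule: less_induct)
  case (less m)
  note hom = unital_alg_homD[OF \<phi>(1)]
  have h: "\<phi> (hsym r) = G_op r" for r
    using \<phi>(2)[of r] by (cases "r = 0") (simp_all add: hom hsym_0 G_op_def)
  \<comment> \<open>The summand i = m carries the factor h_0 = 1 and isolates p_m; the other
    summands agree by induction.\<close>
  have interval: "{1..m} = insert m {1..<m}" using less.prems by auto
  have "(\<Sum>i = 1..m. \<phi> (psym i) * G_op (m - i)) = \<phi> (of_nat m * hsym m)"
    by (simp add: newton_identity hom h)
  also have "\<dots> = (\<Sum>i = 1..m. \<delta>G i 1 * G_op (m - i))"
    by (simp only: hom(8) h newton_\<delta>G)
  also have "\<dots> = \<delta>G m 1 * G_op 0 + (\<Sum>i = 1..<m. \<phi> (psym i) * G_op (m - i))"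
    using less.IH by (simp add: interval del: One_nat_def)
  finally show ?case
    by (simp add: interval G_op_def del: One_nat_def)
qed

text \<open>In Newton's identity the right side involves only h_k with k < r, and the factor r on
  the left acts as an invertible rational scalar.\<close>

lemma hom_hsym_if_hom_psym:
  assumes \<phi>: "unital_alg_hom \<phi>" "\<And>m. m \<ge> 1 \<Longrightarrow> \<phi> (psym m) = \<delta>G m 1"
  shows "\<phi> (hsym r) = G_op r"
proof (induction r rule: less_induct)
  case (less r)
  note hom = unital_alg_homD[OF \<phi>(1)]
  show ?case
  proof (cases "r = 0")
    case False
    have "of_nat r * \<phi> (hsym r) = (\<Sum>i = 1..r. \<phi> (psym i) * \<phi> (hsym (r - i)))"
      by (simp add: newton_identity hom flip: hom(8))
    also have "\<dots> = (\<Sum>i = 1..r. \<delta>G i 1 * G_op (r - i))"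
      by (rule sum.cong[OF refl]) (use \<phi>(2) less.IH in auto)
    finally have "of_nat r * \<phi> (hsym r) = of_nat r * G_op r" by (simp only: newton_\<delta>G)
    thus ?thesis using False of_nat_mult_qxy_end_cancel by blast
  qed (simp add: hsym_0 hom G_op_def)
qed

lemma hom_psym_part:
  assumes \<phi>: "unital_alg_hom \<phi>" "\<And>m. m \<ge> 1 \<Longrightarrow> \<phi> (psym m) = \<delta>G m 1" and "\<mu> \<in> parts"
  shows "\<phi> (psym_part \<mu>) = \<delta>G (sum_mset \<mu>) (size \<mu>)"
  using assms(3)
proof (induction \<mu>)
  case (add m \<mu>)
  hence "m \<ge> 1" "\<mu> \<in> parts" by (auto simp: parts_def Suc_le_eq)
  thus ?case
    using add.IH \<phi> size_le_sum_mset[of \<mu>] \<delta>G_mult[of 1 m "size \<mu>" "sum_mset \<mu>"]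
    by (simp add: unital_alg_homD)
qed (simp add: unital_alg_homD[OF \<phi>(1)] \<delta>G_0_0)

text \<open>The values are prescribed on the power sum basis. The resulting linear map is
  multiplicative because size and length of partitions are additive under union, matching
  \<open>\<delta>G_mult\<close>.\<close>

lemma exists_unital_alg_hom: "\<exists>\<phi>. unital_alg_hom \<phi> \<and> (\<forall>m\<ge>1. \<phi> (psym m) = \<delta>G m 1)"
proof -
  obtain \<phi> where lin: "Vector_Spaces.linear sf_scale end_scale \<phi>"
    and p: "\<And>\<mu>. \<mu> \<in> parts \<Longrightarrow> \<phi> (psym_part \<mu>) = \<delta>G (sum_mset \<mu>) (size \<mu>)"
    using psym_part_linear_extension[OF endo.vector_space_axioms,
        of "\<lambda>\<mu>. \<delta>G (sum_mset \<mu>) (size \<mu>)"] by blast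
  interpret \<phi>: Vector_Spaces.linear sf_scale end_scale \<phi> by fact
  have "\<phi> 1 = 1" using p[of "{#}"] by (simp add: parts_def \<delta>G_0_0)
  moreover have "\<phi> (f * g) = \<phi> f * \<phi> g" for f g
  proof -
    have pp: "\<phi> (psym_part \<mu> * psym_part \<nu>) = \<phi> (psym_part \<mu>) * \<phi> (psym_part \<nu>)"
      if "\<mu> \<in> parts" "\<nu> \<in> parts" for \<mu> \<nu>
    proof -
      have "\<mu> + \<nu> \<in> parts" using that by (auto simp: parts_def)
      thus ?thesis using that
        by (simp add: p \<delta>G_mult size_le_sum_mset flip: psym_part_union)
    qed
    have pg: "\<phi> (psym_part \<mu> * g) = \<phi> (psym_part \<mu>) * \<phi> g" if "\<mu> \<in> parts" for \<mu>
    proof -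
      have "g \<in> sf.span (psym_part ` parts)" by (simp add: span_psym_part)
      thus ?thesis
      proof (induction rule: sf.span_induct_alt)
        case (step c v g)
        thus ?case using pp[OF that]
          by (auto simp: distrib_left sf_scale_mult_right end_scale_mult_right \<phi>.add \<phi>.scale)
      qed simp
    qed
    have "f \<in> sf.span (psym_part ` parts)" by (simp add: span_psym_part)
    thus ?thesis
    proof (induction rule: sf.span_induct_alt)
      case (step c v f)
      thus ?case using pg
        by (auto simp: distrib_right sf_scale_mult_left end_scale_mult_left \<phi>.add \<phi>.scale)
    qed simp
  qed
  moreover have "\<phi> (psym m) = \<delta>G m 1" if "m \<ge> 1" for m
    using p[of "{#m#}"] that by (simp add: parts_def)
  ultimately show ?thesis using lin by (auto simp: unital_alg_hom_def)
qed

text \<open>This justifies the definite description of \<rho>: two candidates agree on all p_m by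
  Newton's identity, hence on the power sum basis.\<close>

lemma unital_alg_hom_\<rho>: "unital_alg_hom \<rho>"
  and \<rho>_psym_part: "\<mu> \<in> parts \<Longrightarrow> \<rho> (psym_part \<mu>) = \<delta>G (sum_mset \<mu>) (size \<mu>)"
proof -
  have "\<exists>!\<phi>. unital_alg_hom \<phi> \<and> (\<forall>r\<ge>1. \<phi> (hsym r) = G_op r)"
  proof (rule ex_ex1I)
    show "\<exists>\<phi>. unital_alg_hom \<phi> \<and> (\<forall>r\<ge>1. \<phi> (hsym r) = G_op r)"
      using exists_unital_alg_hom hom_hsym_if_hom_psym by blast
    fix \<phi> \<psi>
    assume \<phi>: "unital_alg_hom \<phi> \<and> (\<forall>r\<ge>1. \<phi> (hsym r) = G_op r)"
      and \<psi>: "unital_alg_hom \<psi> \<and> (\<forall>r\<ge>1. \<psi> (hsym r) = G_op r)"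
    show "\<phi> = \<psi>"
    proof (rule psym_part_linear_eqI)
      show "Vector_Spaces.linear sf_scale end_scale \<phi>" "Vector_Spaces.linear sf_scale end_scale \<psi>"
        using \<phi> \<psi> by (simp_all add: unital_alg_hom_def)
      show "\<phi> (psym_part \<mu>) = \<psi> (psym_part \<mu>)" if "\<mu> \<in> parts" for \<mu>
        using \<phi> \<psi> that by (simp only: hom_psym_part hom_psym_if_hom_hsym)
    qed
  qed
  from theI'[OF this] have \<rho>: "unital_alg_hom \<rho>" "\<And>r. r \<ge> 1 \<Longrightarrow> \<rho> (hsym r) = G_op r"
    unfolding \<rho>_def by blast+
  show "unital_alg_hom \<rho>" by (rule \<rho>(1))
  show "\<rho> (psym_part \<mu>) = \<delta>G (sum_mset \<mu>) (size \<mu>)" if "\<mu> \<in> parts"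
    using \<rho> that by (simp only: hom_psym_part hom_psym_if_hom_hsym)
qed

lemmas \<rho>_hom = unital_alg_homD[OF unital_alg_hom_\<rho>]

lemma \<rho>_psym: "m \<ge> 1 \<Longrightarrow> \<rho> (psym m) = \<delta>G m 1"
  using \<rho>_psym_part[of "{#m#}"] by (simp add: parts_def)

text \<open>A partition of \<open>n\<close> only for \<open>1 \<le> l \<le> n\<close> and for \<open>l = n = 0\<close>.\<close>

definition hook :: "nat \<Rightarrow> nat \<Rightarrow> nat multiset" where
  "hook n l = (if l = 0 then {#} else add_mset (n - l + 1) (replicate_mset (l - 1) 1))"

lemma hook_in_parts: "hook n l \<in> parts"
  and size_hook: "size (hook n l) = l"
  by (auto simp: hook_def parts_def)

lemma sum_mset_hook: "l \<le> n \<Longrightarrow> (l = 0 \<Longrightarrow> n = 0) \<Longrightarrow> sum_mset (hook n l) = n"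
  by (auto simp: hook_def)

abbreviation hook_of :: "nat multiset \<Rightarrow> nat multiset" where
  "hook_of \<mu> \<equiv> hook (sum_mset \<mu>) (size \<mu>)"

lemma sum_mset_hook_of: "\<mu> \<in> parts \<Longrightarrow> sum_mset (hook_of \<mu>) = sum_mset \<mu>"
  by (rule sum_mset_hook) (auto simp: size_le_sum_mset)

section \<open>Reduction to hooks modulo the relation ideal\<close>

definition relation_ideal :: "symfun set" where
  "relation_ideal =
     sf_ideal.span {psym i * psym (j + 1) - psym (i + 1) * psym j | i j. 1 \<le> i \<and> i < j}"

lemma relation_ideal_add: "f \<in> relation_ideal \<Longrightarrow> g \<in> relation_ideal \<Longrightarrow> f + g \<in> relation_ideal"
  and relation_ideal_diff: "f \<in> relation_ideal \<Longrightarrow> g \<in> relation_ideal \<Longrightarrow> f - g \<in> relation_ideal"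
  and relation_ideal_mult: "f \<in> relation_ideal \<Longrightarrow> g * f \<in> relation_ideal"
  and relation_ideal_zero: "0 \<in> relation_ideal"
  by (auto simp: relation_ideal_def intro: sf_ideal.span_add sf_ideal.span_diff
      sf_ideal.span_scale sf_ideal.span_zero)

text \<open>The expression is antisymmetric in i and j, so the generators with i < j cover all
  pairs.\<close>

lemma psym_exchange:
  assumes "i \<ge> 1" "j \<ge> 1"
  shows "psym i * psym (j + 1) - psym (i + 1) * psym j \<in> relation_ideal"
proof (cases i j rule: linorder_cases)
  case less
  thus ?thesis using assms unfolding relation_ideal_def by (intro sf_ideal.span_base) blast
next
  case equal
  thus ?thesis by (simp add: relation_ideal_zero mult.commute)
next
  case greater
  hence "psym j * psym (i + 1) - psym (j + 1) * psym i \<in> relation_ideal"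
    using assms unfolding relation_ideal_def by (intro sf_ideal.span_base) blast
  hence "0 - (psym j * psym (i + 1) - psym (j + 1) * psym i) \<in> relation_ideal"
    by (rule relation_ideal_diff[OF relation_ideal_zero])
  thus ?thesis by (simp add: mult.commute)
qed

text \<open>Units are moved one at a time from the first index to the second until the first is
  1.\<close>

lemma psym_mult_psym_reduce:
  assumes "m \<ge> 1"
  shows "psym (Suc k) * psym m - psym 1 * psym (k + m) \<in> relation_ideal"
  using assms
proof (induction k arbitrary: m)
  case 0
  show ?case by (simp add: relation_ideal_zero)
next
  case (Suc k)
  have "psym (Suc k) * psym (m + 1) - psym 1 * psym (k + (m + 1)) \<in> relation_ideal"
    using Suc.IH[of "m + 1"] by simp
  moreover have "psym (Suc k) * psym (m + 1) - psym (Suc (Suc k)) * psym m \<in> relation_ideal"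
    using psym_exchange[of "Suc k" m] Suc.prems by simp
  ultimately show ?case
    using relation_ideal_diff by (fastforce simp: algebra_simps)
qed

lemma psym_part_diff_hook_of:
  assumes "\<mu> \<in> parts"
  shows "psym_part \<mu> - psym_part (hook_of \<mu>) \<in> relation_ideal"
  using assms
proof (induction \<mu>)
  case empty
  show ?case by (simp add: hook_def relation_ideal_zero)
next
  case (add m \<mu>)
  hence m: "m \<ge> 1" and \<mu>: "\<mu> \<in> parts" by (auto simp: parts_def Suc_le_eq)
  show ?case
  proof (cases "\<mu> = {#}")
    case True
    thus ?thesis using m by (simp add: hook_def relation_ideal_zero)
  next
    case False
    then obtain l where l: "size \<mu> = Suc l" by (cases "size \<mu>") auto
    \<comment> \<open>By induction \<mu> may be replaced by its hook, with first part k + 1 and l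
      ones, the latter collected in \<open>q\<close>. The parts k + 1 and m then turn into 1 and k +
      m, which gives the hook for the enlarged partition.\<close>
    define k where "k = sum_mset \<mu> - Suc l"
    have k: "sum_mset \<mu> = k + Suc l" using size_le_sum_mset[OF \<mu>] by (simp add: k_def l)
    define q where "q = psym_part (replicate_mset l 1)"
    have h\<mu>: "psym_part (hook_of \<mu>) = psym (Suc k) * q"
      by (simp add: hook_def l k q_def)
    have h: "psym_part (hook_of (add_mset m \<mu>)) = psym (k + m) * (psym 1 * q)"
      using m by (simp add: hook_def l k q_def) (simp add: add.commute)
    have "psym m * (psym_part \<mu> - psym (Suc k) * q) + q * (psym (Suc k) * psym m - psym 1 * psym (k + m))
        \<in> relation_ideal"
      using add.IH[OF \<mu>] psym_mult_psym_reduce[OF m, of k] unfolding h\<mu>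
      by (intro relation_ideal_add relation_ideal_mult)
    moreover have "a * (b - c * d) + d * (c * a - e * f) = a * b - f * (e * d)" for a b c d e f :: symfun
      by (simp add: algebra_simps del: sf_ideal.scale_scale)
    ultimately show ?thesis unfolding h psym_part_add_mset by (simp only:)
  qed
qed

section \<open>The kernel of the homomorphism\<close>

lemma psym_part_expansion:
  assumes "f \<in> sf.span (psym_part ` P)" "P \<subseteq> parts"
  obtains S c where "finite S" "S \<subseteq> P" "f = (\<Sum>\<mu>\<in>S. sf_scale (c \<mu>) (psym_part \<mu>))"
proof -
  obtain A r where A: "finite A" "A \<subseteq> psym_part ` P" "f = (\<Sum>a\<in>A. sf_scale (r a) a)"
    using assms(1) unfolding sf.span_explicit by blast
  obtain S where S: "S \<subseteq> P" "A = psym_part ` S" using A(2) by (meson subset_imageE)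
  have inj: "inj_on psym_part S"
    using inj_on_psym_part S(1) assms(2) by (meson inj_on_subset)
  have "finite S" using A(1) S(2) inj by (simp add: finite_image_iff)
  moreover have "f = (\<Sum>\<mu>\<in>S. sf_scale (r (psym_part \<mu>)) (psym_part \<mu>))"
    unfolding A(3) S(2) by (simp add: sum.reindex[OF inj])
  ultimately show ?thesis using that[of S "\<lambda>\<mu>. r (psym_part \<mu>)"] S(1) by blast
qed

text \<open>Both products in a generator have total degree i + j + 1 and length 2, so they have the
  same image.\<close>

lemma relation_ideal_subset_ker: "f \<in> relation_ideal \<Longrightarrow> \<rho> f = 0"
  unfolding relation_ideal_def
proof (induction rule: sf_ideal.span_induct_alt)
  case (step c v f)
  then obtain i j where "v = psym i * psym (j + 1) - psym (i + 1) * psym j" "1 \<le> i" "i < j" by blast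
  hence "\<rho> v = \<delta>G i 1 * \<delta>G (j + 1) 1 - \<delta>G (i + 1) 1 * \<delta>G j 1"
    by (simp add: \<rho>_hom \<rho>_psym del: One_nat_def)
  also have "\<dots> = 0" using \<open>1 \<le> i\<close> \<open>i < j\<close> by (simp add: \<delta>G_mult)
  finally show ?case using step by (simp add: \<rho>_hom)
qed (simp add: \<rho>_hom)

text \<open>A linear normal form: it changes f only by an element of the ideal and, as shown next,
  vanishes on the kernel. Together these put the kernel inside the ideal.\<close>

definition hook_proj :: "symfun \<Rightarrow> symfun" where
  "hook_proj = (SOME \<phi>. Vector_Spaces.linear sf_scale sf_scale \<phi> \<and>
     (\<forall>\<mu>\<in>parts. \<phi> (psym_part \<mu>) = psym_part (hook_of \<mu>)))"

lemma linear_hook_proj: "Vector_Spaces.linear sf_scale sf_scale hook_proj"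
  and hook_proj_psym_part: "\<mu> \<in> parts \<Longrightarrow> hook_proj (psym_part \<mu>) = psym_part (hook_of \<mu>)"
  using someI_ex[OF psym_part_linear_extension[OF sf.vector_space_axioms,
      of "\<lambda>\<mu>. psym_part (hook_of \<mu>)"]]
  by (simp_all add: hook_proj_def)

interpretation hook_proj: Vector_Spaces.linear sf_scale sf_scale hook_proj
  by (rule linear_hook_proj)

text \<open>Group the expansion of f by size n and length l. Both \<rho> f and the projection depend
  only on the group sums \<open>C n l\<close>, and linear independence of the operators forces these
  to be 0.\<close>

lemma hook_proj_eq_0:
  assumes "\<rho> f = 0"
  shows "hook_proj f = 0"
proof -
  obtain S c where S: "finite S" "S \<subseteq> parts" and f: "f = (\<Sum>\<mu>\<in>S. sf_scale (c \<mu>) (psym_part \<mu>))"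
    using psym_part_expansion[of f parts] by (auto simp: span_psym_part)
  define t where "t \<mu> = (sum_mset \<mu>, size \<mu>)" for \<mu> :: "nat multiset"
  define C where "C n l = (\<Sum>\<mu> | \<mu> \<in> S \<and> t \<mu> = (n, l). c \<mu>)" for n l
  have "0 = (\<Sum>\<mu>\<in>S. end_scale (c \<mu>) (\<delta>G (sum_mset \<mu>) (size \<mu>)))"
    using assms f S(2) by (simp add: \<rho>_hom \<rho>_psym_part subset_iff)
  also have "\<dots> = (\<Sum>y\<in>t ` S. \<Sum>\<mu> | \<mu> \<in> S \<and> t \<mu> = y. end_scale (c \<mu>) (\<delta>G (sum_mset \<mu>) (size \<mu>)))"
    by (rule sum.image_gen[OF S(1)])
  also have "\<dots> = (\<Sum>(n, l)\<in>t ` S. end_scale (C n l) (\<delta>G n l))"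
    by (rule sum.cong[OF refl]) (auto simp: C_def endo.scale_sum_left t_def intro!: sum.cong)
  finally have "(\<Sum>(n, l)\<in>t ` S. end_scale (C n l) (\<delta>G n l)) = 0" by simp
  hence C: "C n l = 0" if "(n, l) \<in> t ` S" for n l
    using \<delta>G_independent[of "t ` S" C n l] S that size_le_sum_mset by (auto simp: t_def)
  have "hook_proj f = (\<Sum>\<mu>\<in>S. sf_scale (c \<mu>) (psym_part (hook_of \<mu>)))"
    using f S(2) by (simp add: hook_proj.sum hook_proj.scale hook_proj_psym_part subset_iff)
  also have "\<dots> = (\<Sum>y\<in>t ` S. \<Sum>\<mu> | \<mu> \<in> S \<and> t \<mu> = y. sf_scale (c \<mu>) (psym_part (hook_of \<mu>)))"
    by (rule sum.image_gen[OF S(1)])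
  also have "\<dots> = (\<Sum>(n, l)\<in>t ` S. sf_scale (C n l) (psym_part (hook n l)))"
    by (rule sum.cong[OF refl]) (auto simp: C_def sf.scale_sum_left t_def intro!: sum.cong)
  also have "\<dots> = 0" using C by (intro sum.neutral) (force split: prod.split)
  finally show ?thesis .
qed

lemma diff_hook_proj_in_relation_ideal: "f - hook_proj f \<in> relation_ideal"
proof -
  have "f \<in> sf.span (psym_part ` parts)" by (simp add: span_psym_part)
  thus ?thesis
  proof (induction rule: sf.span_induct_alt)
    case base
    show ?case by (simp add: relation_ideal_zero)
  next
    case (step c v f)
    then obtain \<mu> where \<mu>: "\<mu> \<in> parts" "v = psym_part \<mu>" by blast
    \<comment> \<open>Writing the scalar as a ring element makes closure under multiplication
      applicable.\<close>
    have "sf_scale c 1 * (v - hook_proj v) + (f - hook_proj f) \<in> relation_ideal"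
      using step psym_part_diff_hook_of[OF \<mu>(1)] \<mu>
      by (intro relation_ideal_add relation_ideal_mult) (simp_all add: hook_proj_psym_part)
    hence "sf_scale c (v - hook_proj v) + (f - hook_proj f) \<in> relation_ideal"
      by (simp flip: sf_scale_conv_mult)
    thus ?case
      by (simp add: hook_proj.add hook_proj.scale sf.scale_right_diff_distrib algebra_simps)
  qed
qed

lemma ker_\<rho>: "{f. \<rho> f = 0} = relation_ideal"
proof (intro equalityI subsetI)
  fix f assume "f \<in> {f. \<rho> f = 0}"
  thus "f \<in> relation_ideal"
    using diff_hook_proj_in_relation_ideal[of f] by (simp add: hook_proj_eq_0)
qed (simp add: relation_ideal_subset_ker)

section \<open>Homogeneous components: image and dimension of the kernel\<close>

lemma partitions_subset_parts: "partitions n \<subseteq> parts"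
  by (auto simp: partitions_def parts_def)

lemma hook_in_partitions: "1 \<le> l \<Longrightarrow> l \<le> n \<Longrightarrow> hook n l \<in> partitions n"
  using hook_in_parts[of n l] by (simp add: partitions_def parts_def sum_mset_hook)

text \<open>Partitions of n >= 1 have length between 1 and n, and hooks realise every such
  length.\<close>

lemma \<rho>_image_homogeneous:
  assumes "n \<ge> 1"
  shows "\<rho> ` sf_homogeneous n = endo.span {\<delta>E n l | l. 1 \<le> l \<and> l \<le> n}"
proof -
  interpret \<rho>: Vector_Spaces.linear sf_scale end_scale \<rho>
    using unital_alg_hom_\<rho> by (simp add: unital_alg_hom_def)
  have "\<rho> ` psym_part ` partitions n = {\<delta>E n l | l. 1 \<le> l \<and> l \<le> n}"
  proof (intro equalityI subsetI)
    fix T assume "T \<in> \<rho> ` psym_part ` partitions n"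
    then obtain \<mu> where \<mu>: "\<mu> \<in> partitions n" "T = \<rho> (psym_part \<mu>)" by blast
    hence "\<mu> \<in> parts" "size \<mu> \<le> n" "sum_mset \<mu> = n"
      using partitions_subset_parts size_le_sum_mset[of \<mu>] by (auto simp: partitions_def)
    moreover have "1 \<le> size \<mu>" using calculation(3) assms by (cases \<mu>) auto
    ultimately show "T \<in> {\<delta>E n l | l. 1 \<le> l \<and> l \<le> n}"
      using \<mu>(2) by (auto simp: \<rho>_psym_part simp flip: \<delta>E_eq)
  next
    fix T assume "T \<in> {\<delta>E n l | l. 1 \<le> l \<and> l \<le> n}"
    then obtain l where l: "T = \<delta>E n l" "1 \<le> l" "l \<le> n" by blast
    hence "T = \<rho> (psym_part (hook n l))"
      by (simp add: \<rho>_psym_part hook_in_parts sum_mset_hook size_hook \<delta>E_eq)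
    thus "T \<in> \<rho> ` psym_part ` partitions n" using hook_in_partitions l by blast
  qed
  thus ?thesis by (simp only: sf_homogeneous_eq_span flip: \<rho>.span_image)
qed

text \<open>A finite spanning set is asserted as well, because \<open>dim\<close> is 0 by convention
  on infinite-dimensional spaces. Integers avoid truncated subtraction.\<close>

lemma ker_\<rho>_homogeneous:
  assumes "n \<ge> 1"
  defines "V \<equiv> {f \<in> sf_homogeneous n. \<rho> f = 0}"
  shows "\<exists>B. finite B \<and> sf.span B = V"
    and "int (sf.dim V) = int (card (partitions n)) - int n"
proof -
  define H where "H = hook n ` {1..n}"
  define P where "P = partitions n - H"
  define g where "g \<mu> = psym_part \<mu> - psym_part (hook_of \<mu>)" for \<mu>
  have H: "H \<subseteq> partitions n" by (auto simp: H_def hook_in_partitions)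
  have hook_of: "hook_of \<mu> \<in> H" if "\<mu> \<in> partitions n" for \<mu>
  proof -
    have "sum_mset \<mu> = n" "size \<mu> \<le> n"
      using that partitions_subset_parts size_le_sum_mset[of \<mu>] by (auto simp: partitions_def)
    moreover have "1 \<le> size \<mu>" using calculation(1) assms by (cases \<mu>) auto
    ultimately show ?thesis by (auto simp: H_def)
  qed
  have hook_of_hook: "hook_of \<mu> = \<mu>" if "\<mu> \<in> H" for \<mu>
    using that by (auto simp: H_def size_hook sum_mset_hook)
  have P: "finite P" "P \<subseteq> partitions n" "P \<subseteq> parts"
    using finite_partitions partitions_subset_parts by (auto simp: P_def)
  have "sf.subspace V"
    unfolding V_def using subspace_sf_homogeneous[of n]
    by (auto simp: sf.subspace_def \<rho>_hom)
  moreover have "g ` P \<subseteq> V"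
  proof safe
    fix \<mu> assume "\<mu> \<in> P"
    hence \<mu>: "\<mu> \<in> partitions n" "\<mu> \<in> parts" using P by auto
    have "hook_of \<mu> \<in> partitions n" using hook_of[OF \<mu>(1)] H by blast
    hence "g \<mu> \<in> sf_homogeneous n"
      unfolding g_def sf_homogeneous_eq_span using \<mu>(1)
      by (intro sf.span_diff sf.span_base imageI)
    moreover have "\<rho> (g \<mu>) = 0"
      using \<mu>(2) by (simp add: g_def \<rho>_hom \<rho>_psym_part hook_in_parts sum_mset_hook_of size_hook)
    ultimately show "g \<mu> \<in> V" by (simp add: V_def)
  qed
  ultimately have sub: "sf.span (g ` P) \<subseteq> V" by (simp add: sf.span_minimal)
  have "f - hook_proj f \<in> sf.span (g ` P)" if "f \<in> sf.span (psym_part ` partitions n)" for f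
    using that
  proof (induction rule: sf.span_induct_alt)
    case base
    show ?case by (simp add: sf.span_zero)
  next
    case (step c v f)
    then obtain \<mu> where \<mu>: "\<mu> \<in> partitions n" "v = psym_part \<mu>" by blast
    hence v: "v - hook_proj v = g \<mu>"
      using subsetD[OF partitions_subset_parts \<mu>(1)] by (simp add: g_def hook_proj_psym_part)
    have "g \<mu> \<in> sf.span (g ` P)"
    proof (cases "\<mu> \<in> H")
      case True
      thus ?thesis by (simp add: g_def hook_of_hook sf.span_zero)
    next
      case False
      thus ?thesis using \<mu>(1) by (auto simp: P_def intro: sf.span_base)
    qed
    hence "sf_scale c (v - hook_proj v) + (f - hook_proj f) \<in> sf.span (g ` P)"
      unfolding v using step by (intro sf.span_add sf.span_scale)
    thus ?case
      by (simp add: hook_proj.add hook_proj.scale sf.scale_right_diff_distrib algebra_simps)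
  qed
  \<comment> \<open>For f in the kernel the projection is 0, so f itself lies in the span of the
    differences.\<close>
  hence "V \<subseteq> sf.span (g ` P)"
    unfolding V_def sf_homogeneous_eq_span using hook_proj_eq_0 by fastforce
  with sub have span: "sf.span (g ` P) = V" by blast
  thus "\<exists>B. finite B \<and> sf.span B = V" using P(1) by blast
  text \<open>Annihilating the hooks sends \<open>g \<mu>\<close> back to \<open>p\<^sub>\<mu>\<close>.\<close>
  obtain \<pi> where "Vector_Spaces.linear sf_scale sf_scale \<pi>"
    and \<pi>_part: "\<And>\<mu>. \<mu> \<in> parts \<Longrightarrow> \<pi> (psym_part \<mu>) = (if \<mu> \<in> H then 0 else psym_part \<mu>)"
    using psym_part_linear_extension[OF sf.vector_space_axioms,
        of "\<lambda>\<mu>. if \<mu> \<in> H then 0 else psym_part \<mu>"] by blast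
  then interpret \<pi>: Vector_Spaces.linear sf_scale sf_scale \<pi> by blast
  have \<pi>g: "\<pi> (g \<mu>) = psym_part \<mu>" if "\<mu> \<in> P" for \<mu>
    using that P hook_of[of \<mu>] by (auto simp: g_def \<pi>.diff \<pi>_part hook_in_parts P_def)
  have inj: "inj_on g P"
    by (metis P(3) \<pi>g inj_onI inj_on_psym_part inj_on_contraD subsetD)
  have "sf.independent (g ` P)"
    unfolding sf.independent_explicit_finite_subsets
  proof (intro allI impI ballI)
    fix A u v assume A: "A \<subseteq> g ` P" "finite A" "(\<Sum>v\<in>A. sf_scale (u v) v) = 0" "v \<in> A"
    obtain S where S: "S \<subseteq> P" "A = g ` S" by (metis A(1) subset_imageE)
    have "inj_on g S" using inj S(1) by (meson inj_on_subset)
    hence "\<pi> (\<Sum>\<mu>\<in>S. sf_scale (u (g \<mu>)) (g \<mu>)) = 0"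
      using A(3) S(2) by (simp add: sum.reindex)
    moreover have "\<pi> (\<Sum>\<mu>\<in>S. sf_scale (u (g \<mu>)) (g \<mu>)) = (\<Sum>\<mu>\<in>S. sf_scale (u (g \<mu>)) (psym_part \<mu>))"
      using S(1) \<pi>g by (auto simp: \<pi>.sum \<pi>.scale intro!: sum.cong)
    ultimately have "(\<Sum>\<mu>\<in>S. sf_scale (u (g \<mu>)) (psym_part \<mu>)) = 0" by simp
    moreover have "finite S" using S(1) P(1) by (rule finite_subset)
    ultimately show "u v = 0"
      using sum_psym_part_eq_0D[of S "u \<circ> g"] S P(3) A(4) by (auto simp: parts_def)
  qed
  hence "sf.dim V = card (g ` P)"
    by (metis span sf.dim_span sf.dim_eq_card_independent)
  also have "\<dots> = card (partitions n) - card H"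
    using inj finite_subset[OF H finite_partitions] H by (simp add: card_image P_def card_Diff_subset)
  also have "card H = n"
  proof -
    have "inj_on (hook n) {1..n}" by (rule inj_onI) (metis size_hook)
    thus ?thesis by (simp add: H_def card_image)
  qed
  finally show "int (sf.dim V) = int (card (partitions n)) - int n"
    using card_mono[OF finite_partitions H] \<open>card H = n\<close> by simp
qed

theorem proposition16:
  "(\<forall>m\<ge>1. \<rho> (psym m) = \<delta>E m 1 \<and> \<delta>E m 1 = mult_op \<delta> ^ (m - 1) * G_op 1) \<and>
   (\<forall>n. \<forall>\<mu>\<in>partitions n. \<rho> (psym_part \<mu>) = \<delta>E n (size \<mu>)) \<and>
   {f. \<rho> f = 0} =
     sf_ideal.span {psym i * psym (j + 1) - psym (i + 1) * psym j | i j. 1 \<le> i \<and> i < j} \<and>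
   (\<forall>n\<ge>1. \<rho> ` sf_homogeneous n = endo.span {\<delta>E n l | l. 1 \<le> l \<and> l \<le> n}) \<and>
   (\<forall>n\<ge>1. (\<exists>B. finite B \<and> sf.span B = {f \<in> sf_homogeneous n. \<rho> f = 0}) \<and>
      int (sf.dim {f \<in> sf_homogeneous n. \<rho> f = 0}) = int (card (partitions n)) - int n)"
proof (intro conjI allI impI ballI)
  fix m :: nat assume m: "m \<ge> 1"
  show "\<rho> (psym m) = \<delta>E m 1" "\<delta>E m 1 = mult_op \<delta> ^ (m - 1) * G_op 1"
    using m by (simp_all only: \<rho>_psym \<delta>E_eq \<delta>G_1)
next
  fix n \<mu> assume "\<mu> \<in> partitions n"
  hence "\<mu> \<in> parts" "sum_mset \<mu> = n" using partitions_subset_parts by (auto simp: partitions_def)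
  thus "\<rho> (psym_part \<mu>) = \<delta>E n (size \<mu>)"
    using size_le_sum_mset[of \<mu>] by (simp add: \<rho>_psym_part \<delta>E_eq)
next
  show "{f. \<rho> f = 0} =
      sf_ideal.span {psym i * psym (j + 1) - psym (i + 1) * psym j | i j. 1 \<le> i \<and> i < j}"
    by (simp only: ker_\<rho> relation_ideal_def)
qed (use \<rho>_image_homogeneous ker_\<rho>_homogeneous in auto)

end
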